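(* There are absolute constants $C, c > 0$ such that for every convex body $K \subset B_\infty^n$, every $1 < p < \infty$ and any $0 < t < 1$, $$\log N(K, n^{1/p} B_p^n, t) \le C p^2 \log^2 (2/t) \cdot \mathrm{VC}(K, ct).$$ Moreover, $$\log N(K, B_\infty^n, t) \le C M^2 \log^2 (2/t) \cdot \mathrm{VC}(K, ct),$$ provided that either the right-hand side or the left-hand side of this last inequality is larger than $t^M n$.
   Context: $n$ is a positive integer, $B_p^n$ is the unit ball of $\ell_p^n$ in $\mathbb{R}^n$, and $B_\infty^n = [-1,1]^n$. For sets $K, D \subset \mathbb{R}^n$ and $t>0$, the covering number $N(K,D,t)$ is the minimal number of translates of $tD$ in $\mathbb{R}^n$ needed to cover $K$. For a convex body $K \subset \mathbb{R}^n$ and $t>0$, $\mathrm{VC}(K,t)$ is the maximal cardinality of a subset $\sigma \subset \{1,\dots,n\}$ such that the coordinate projection of $K$ onto $\mathbb{R}^\sigma$ contains a coordinate cube of the form $x + [0,t]^\sigma$ for some $x \in \mathbb{R}^\sigma$; if no such $\sigma$ exists, $\mathrm{VC}(K,t)=0$. In the second inequality $M$ is a parameter, appearing both in the coefficient $M^2$ and in the proviso; no further restriction on $M$ is stated.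
   Formalization: The second inequality is stated for real M ≥ 1; with M unrestricted it fails (K = B_∞^n, t = 1/10, M → 0: the left side n log 10 exceeds t^M n while the right side tends to 0). Any fixed lower bound M ≥ M_0 > 0 follows by enlarging C. *)

theory Defs
  imports "HOL-Analysis.Analysis" "HOL-Library.Function_Algebras"
begin

text \<open>
  The dimension \<open>n\<close> is quantified inside the theorem (the constants do not depend on it), so
  \<open>\<real>\<^sup>n\<close> is the carrier of the library's \<^const>\<open>Euclidean_space\<close> \<open>n\<close>: functions \<open>x :: nat \<Rightarrow> real\<close>
  with \<open>x i = 0\<close> for \<open>i \<ge> n\<close>. Coordinates are numbered \<open>0, \<dots>, n - 1\<close>. Addition of functions is
  pointwise (\<^theory>\<open>HOL-Library.Function_Algebras\<close>); the pointwise scalar multiplication below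
  makes the library's \<^const>\<open>convex\<close> available.
\<close>

instantiation "fun" :: (type, real_vector) real_vector
begin

definition scaleR_fun :: "real \<Rightarrow> ('a \<Rightarrow> 'b) \<Rightarrow> 'a \<Rightarrow> 'b"
  where "scaleR_fun r f = (\<lambda>x. r *\<^sub>R f x)"

instance
  by standard (simp_all add: scaleR_fun_def plus_fun_def scaleR_add_right scaleR_add_left)

end

definition convex_body :: "nat \<Rightarrow> (nat \<Rightarrow> real) set \<Rightarrow> bool"
  where "convex_body n K \<longleftrightarrow>
    convex K \<and> compactin (Euclidean_space n) K \<and> Euclidean_space n interior_of K \<noteq> {}"

definition lp_ball :: "real \<Rightarrow> nat \<Rightarrow> (nat \<Rightarrow> real) set"
  where "lp_ball p n =
    {x \<in> topspace (Euclidean_space n). (\<Sum>i<n. \<bar>x i\<bar> powr p) powr (1 / p) \<le> 1}"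

definition linf_ball :: "nat \<Rightarrow> (nat \<Rightarrow> real) set"
  where "linf_ball n = {x \<in> topspace (Euclidean_space n). \<forall>i<n. \<bar>x i\<bar> \<le> 1}"

text \<open>
  The covering number is used only for bounded \<open>K\<close>, for \<open>D\<close> a neighbourhood of the origin in
  \<open>\<real>\<^sup>n\<close> and for \<open>t > 0\<close>, so finite covers exist and the minimum is attained.
\<close>

definition covering_number ::
    "nat \<Rightarrow> (nat \<Rightarrow> real) set \<Rightarrow> (nat \<Rightarrow> real) set \<Rightarrow> real \<Rightarrow> nat"
  where "covering_number n K D t =
    (LEAST m. \<exists>T. T \<subseteq> topspace (Euclidean_space n) \<and> finite T \<and> card T = m \<and>
       K \<subseteq> (\<Union>x\<in>T. (\<lambda>d. x + t *\<^sub>R d) ` D))"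

text \<open>
  \<open>\<real>\<^sup>\<sigma>\<close> consists of the functions that are \<^const>\<open>undefined\<close> outside \<open>\<sigma>\<close>, so the coordinate
  projection is \<^const>\<open>restrict\<close> and the cube \<open>x + [0,t]\<^sup>\<sigma>\<close> is a \<^const>\<open>PiE\<close>. Inserting \<open>0\<close>
  covers the case that no \<open>\<sigma>\<close> is admissible.
\<close>

definition VC :: "nat \<Rightarrow> (nat \<Rightarrow> real) set \<Rightarrow> real \<Rightarrow> nat"
  where "VC n K t =
    Max (insert 0 (card ` {\<sigma>. \<sigma> \<subseteq> {..<n} \<and>
      (\<exists>x :: nat \<Rightarrow> real. (\<Pi>\<^sub>E i\<in>\<sigma>. {x i..x i + t}) \<subseteq> (\<lambda>y. restrict y \<sigma>) ` K)}))"

end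

theory Submission
  imports Defs
begin

text \<open>
Both inequalities come from one combinatorial statement about a finite family \<open>A\<close> of functions on
\<open>n\<close> coordinates with values in \<open>[-1, 1]\<close> that is \<open>t\<close>-separated in the maximum norm: if
\<open>L = ln (card A)\<close> is not much smaller than \<open>n\<close>, namely \<open>n \<le> (2 / t)\<^sup>M L\<close>, then
\<open>L \<le> C M\<^sup>2 ln\<^sup>2 (2 / t) d\<close>, where \<open>d\<close> is the largest size of a coordinate set that \<open>A\<close> shatters with gaps
\<open>t / 5\<close>. Shattering means that every pattern of low and high values occurs. No convexity enters
here; it is used only to see that a convex set containing a shattering family projects onto a set
containing the whole cube between the low and the high values (\<open>convex_fills_cube\<close>). A maximal
separated subset of \<open>K\<close> is a net, so its cardinality dominates the covering number.

The combinatorial statement is proved for the integer parts of the values at scale \<open>t / 5\<close>, by a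
version of the Sauer--Shelah lemma. If a coordinate and a level split \<open>A\<close> into a lower and an upper
part, then \<open>A\<close> shatters at least as many pairs of a coordinate set and a choice of levels on it as
the two parts together (\<open>card_shattered_maps_split\<close>). If every subfamily can be split so that
one side keeps one half and the other a fraction \<open>\<delta>\<close>, this yields \<open>(card A)\<^sup>\<theta>\<close> shattered pairs with
\<open>\<theta>\<close> of the order \<open>1 / ln (1 / \<delta>)\<close> (\<open>powr_card_le_card_shattered_maps\<close>), whereas there are
at most about \<open>(C n / (t d))\<^sup>d\<close> such pairs.

The fraction \<open>\<delta>\<close> must not depend on \<open>n\<close>. A family in which any two members differ in a fraction \<open>\<mu>\<close> of
all coordinates splits with \<open>\<delta> = \<mu> / 8\<close>, at the median of a suitable coordinate
(\<open>far_pairs_split\<close>). Maximum norm separation guarantees just one coordinate; but members that differ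
noticeably from a given one in few coordinates only are few, so a family of \<open>N\<close> functions contains
\<open>\<surd>N\<close> functions that pairwise differ in a fraction \<open>\<mu> = (t / 2)\<^sup>7\<^sup>M\<close> of the coordinates
(\<open>far_subset_exists\<close>). This uses that \<open>n\<close> is at most \<open>(2 / t)\<^sup>M L\<close>. Then
\<open>1 / \<theta>\<close> and \<open>ln (C n / (t d))\<close> are each of the order \<open>M ln (2 / t)\<close>, up to \<open>ln (L / d)\<close>, and their product
is the claimed coefficient (\<open>ln_card_le_shatter_dim\<close>).

For the maximum norm the relation between \<open>L\<close> and \<open>n\<close> is the proviso: the
inequality is trivial if only its right-hand side exceeds \<open>t\<^sup>M n\<close>. For the \<open>p\<close>-norm it is arranged by
choosing coordinates: \<open>t\<close>-separated functions differ by \<open>t / 2\<close> in a fraction \<open>(t / 4)\<^sup>p\<close> of the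
coordinates, so at most \<open>4 (4 / t)\<^sup>p L\<close> coordinates suffice to separate all of them in the maximum norm
(\<open>separating_coordinates\<close>), and the statement applies to these coordinates with \<open>M = p + 1\<close>.
\<close>

section \<open>Shattered partial maps\<close>

text \<open>
A pair of a coordinate set \<open>\<sigma>\<close> and a level for each of its coordinates is one partial map with
domain \<open>\<sigma>\<close>.
\<close>

definition partial_maps :: "'i set \<Rightarrow> 'v set \<Rightarrow> ('i \<rightharpoonup> 'v) set"
  where "partial_maps I V = {m. dom m \<subseteq> I \<and> ran m \<subseteq> V}"

text \<open>
Both inequalities are strict, so the values on the two sides of a level differ by at least 2. This
is what leaves a gap between the real numbers of which they are the integer parts.
\<close>

definition shatters :: "('i \<Rightarrow> int) set \<Rightarrow> ('i \<rightharpoonup> int) \<Rightarrow> bool"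
  where "shatters A m \<longleftrightarrow> (\<forall>\<tau> \<subseteq> dom m. \<exists>f\<in>A.
    (\<forall>i\<in>\<tau>. the (m i) < f i) \<and> (\<forall>i\<in>dom m - \<tau>. f i < the (m i)))"

definition shattered_maps :: "'i set \<Rightarrow> int set \<Rightarrow> ('i \<Rightarrow> int) set \<Rightarrow> ('i \<rightharpoonup> int) set"
  where "shattered_maps I V A = {m \<in> partial_maps I V. shatters A m}"

section \<open>Counting partial maps\<close>

lemma partial_maps_empty: "partial_maps {} V = {Map.empty}"
  by (auto simp: partial_maps_def)

lemma partial_maps_insert:
  assumes "i \<notin> I"
  shows "partial_maps (insert i I) V =
    partial_maps I V \<union> (\<lambda>(m, v). m(i \<mapsto> v)) ` (partial_maps I V \<times> V)"
proof (intro subset_antisym subsetI)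
  fix m assume m: "m \<in> partial_maps (insert i I) V"
  show "m \<in> partial_maps I V \<union> (\<lambda>(m, v). m(i \<mapsto> v)) ` (partial_maps I V \<times> V)"
  proof (cases "m i")
    case None
    then have "m \<in> partial_maps I V" using m by (auto simp: partial_maps_def)
    then show ?thesis by simp
  next
    case (Some v)
    have "m = (m(i := None))(i \<mapsto> v)" using Some by auto
    moreover have "m(i := None) \<in> partial_maps I V" 
      using m by (auto simp: partial_maps_def ran_def)
    moreover have "v \<in> V" using m Some by (auto simp: partial_maps_def ran_def)
    ultimately show ?thesis by (intro UnI2 image_eqI[where x="(m(i := None), v)"]) auto
  qed
next
  fix m assume "m \<in> partial_maps I V \<union> (\<lambda>(m, v). m(i \<mapsto> v)) ` (partial_maps I V \<times> V)"
  then show "m \<in> partial_maps (insert i I) V"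
    unfolding partial_maps_def ran_def by (fastforce split: if_splits)
qed

lemma finite_partial_maps:
  assumes "finite I" "finite V" shows "finite (partial_maps I V)"
  using assms(1)
  by (induction I rule: finite_induct)
     (simp_all add: partial_maps_empty partial_maps_insert assms(2))

text \<open>
Each coordinate is either undefined, with weight \<open>1\<close>, or takes one of \<open>card V\<close> values, each with
weight \<open>x\<close>; so the generating function is a product.
\<close>

lemma sum_partial_maps:
  fixes x :: real
  assumes "finite I" and V: "finite V"
  shows "(\<Sum>m\<in>partial_maps I V. x ^ card (dom m)) = (1 + real (card V) * x) ^ card I"
  using assms(1)
proof (induction I rule: finite_induct)
  case empty
  then show ?case by (simp add: partial_maps_empty)
next
  case (insert i I)
  let ?P = "partial_maps I V" and ?g = "\<lambda>(m, v). m(i \<mapsto> v)"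
  have fin: "finite ?P" using insert V finite_partial_maps by blast
  have undef: "m i = None" if "m \<in> ?P" for m
    using that insert by (auto simp: partial_maps_def)
  have inj: "inj_on ?g (?P \<times> V)"
  proof (rule inj_onI, clarify)
    fix m v m' v' assume h: "m \<in> ?P" "m' \<in> ?P" "m(i \<mapsto> v) = m'(i \<mapsto> v')"
    have "v = v'" using fun_cong[OF h(3), of i] by simp
    moreover have "m = m'"
    proof
      fix j show "m j = m' j" using fun_cong[OF h(3), of j] undef[OF h(1)] undef[OF h(2)]
        by (cases "j = i") auto
    qed
    ultimately show "m = m' \<and> v = v'" by simp
  qed
  have disj: "?P \<inter> ?g ` (?P \<times> V) = {}" using undef by fastforce
  have "(\<Sum>m\<in>partial_maps (insert i I) V. x ^ card (dom m)) =
      (\<Sum>m\<in>?P. x ^ card (dom m)) + (\<Sum>m\<in>?g ` (?P \<times> V). x ^ card (dom m))"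
    unfolding partial_maps_insert[OF insert(2)] using fin V disj
    by (intro sum.union_disjoint) auto
  also have "(\<Sum>m\<in>?g ` (?P \<times> V). x ^ card (dom m)) =
      (\<Sum>(m, v)\<in>?P \<times> V. x ^ card (dom (m(i \<mapsto> v))))"
    by (subst sum.reindex[OF inj]) (simp add: case_prod_unfold)
  also have "\<dots> = (\<Sum>(m, v)\<in>?P \<times> V. x * x ^ card (dom m))"
  proof (intro sum.cong refl, clarify)
    fix m v assume m: "m \<in> ?P"
    have "finite (dom m)" using m insert(1) by (auto simp: partial_maps_def intro: finite_subset)
    moreover have "i \<notin> dom m" using undef[OF m] by auto
    ultimately show "x ^ card (dom (m(i \<mapsto> v))) = x * x ^ card (dom m)" by simp
  qed
  also have "\<dots> = (\<Sum>m\<in>?P. \<Sum>v\<in>V. x * x ^ card (dom m))"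
    by (rule sum.cartesian_product[symmetric])
  also have "\<dots> = real (card V) * x * (\<Sum>m\<in>?P. x ^ card (dom m))"
    by (simp add: sum_distrib_left mult_ac)
  finally show ?case using insert by (simp add: algebra_simps)
qed

text \<open>
The usual estimate for a partial sum of \<open>\<Sum>\<^sub>k (n choose k) b\<^sup>k\<close>: for \<open>x \<le> 1\<close> every map of domain size at
most \<open>D\<close> has weight at least \<open>x\<^sup>D\<close> in the generating function. The parameter \<open>x\<close> stays free; it
will be chosen of the order of \<open>D / (n b)\<close>.
\<close>

lemma card_partial_maps_le:
  fixes x D :: real
  assumes "finite I" "finite V" "0 < x" "x \<le> 1"
  shows "real (card {m \<in> partial_maps I V. real (card (dom m)) \<le> D})
    \<le> exp (D * ln (1 / x) + real (card I) * real (card V) * x)"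
proof -
  let ?S = "{m \<in> partial_maps I V. real (card (dom m)) \<le> D}"
  have fin: "finite (partial_maps I V)" using assms finite_partial_maps by blast
  have "real (card ?S) * x powr D = (\<Sum>m\<in>?S. x powr D)" by simp
  also have "\<dots> \<le> (\<Sum>m\<in>?S. x ^ card (dom m))"
  proof (rule sum_mono)
    fix m assume "m \<in> ?S"
    then have "x powr D \<le> x powr (real (card (dom m)))"
      using assms by (intro powr_mono') auto
    then show "x powr D \<le> x ^ card (dom m)" using assms by (simp add: powr_realpow)
  qed
  also have "\<dots> \<le> (\<Sum>m\<in>partial_maps I V. x ^ card (dom m))"
    using fin assms by (intro sum_mono2) auto
  also have "\<dots> = (1 + real (card V) * x) ^ card I"
    using assms by (simp add: sum_partial_maps)
  also have "\<dots> \<le> exp (real (card V) * x) ^ card I"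
    using assms by (intro power_mono exp_ge_add_one_self) auto
  also have "\<dots> = exp (real (card I) * real (card V) * x)"
    by (simp add: exp_of_nat_mult[symmetric] mult_ac)
  finally have "real (card ?S) * x powr D \<le> exp (real (card I) * real (card V) * x)" .
  moreover have "x powr D = exp (- (D * ln (1 / x)))"
    using assms by (simp add: powr_def ln_div)
  ultimately have "real (card ?S) \<le> exp (real (card I) * real (card V) * x) / exp (- (D * ln (1 / x)))"
    by (simp add: le_divide_eq)
  also have "\<dots> = exp (D * ln (1 / x) + real (card I) * real (card V) * x)"
    by (simp add: exp_diff[symmetric] add.commute)
  finally show ?thesis .
qed

section \<open>A Sauer--Shelah inequality\<close>

lemma finite_shattered_maps:
  assumes "finite I" "finite V" shows "finite (shattered_maps I V A)"
  using finite_partial_maps[OF assms] by (auto simp: shattered_maps_def)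

lemma shatters_mono: "shatters B m \<Longrightarrow> B \<subseteq> A \<Longrightarrow> shatters A m"
  unfolding shatters_def by blast

text \<open>
The functions of \<open>B\<^sub>1\<close> realise the patterns that are low at the new coordinate, those of \<open>B\<^sub>2\<close> the
patterns that are high there.
\<close>

lemma shatters_upd:
  assumes lo: "\<And>f. f \<in> B\<^sub>1 \<Longrightarrow> f i < k" and hi: "\<And>f. f \<in> B\<^sub>2 \<Longrightarrow> k < f i"
    and sh: "shatters B\<^sub>1 m" "shatters B\<^sub>2 m" and i: "i \<notin> dom m"
  shows "shatters (B\<^sub>1 \<union> B\<^sub>2) (m(i \<mapsto> k))"
  unfolding shatters_def
proof (intro allI impI)
  fix \<tau> assume t: "\<tau> \<subseteq> dom (m(i \<mapsto> k))"
  have t': "\<tau> - {i} \<subseteq> dom m" using t by auto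
  show "\<exists>f\<in>B\<^sub>1 \<union> B\<^sub>2. (\<forall>j\<in>\<tau>. the ((m(i \<mapsto> k)) j) < f j) \<and>
      (\<forall>j\<in>dom (m(i \<mapsto> k)) - \<tau>. f j < the ((m(i \<mapsto> k)) j))"
  proof (cases "i \<in> \<tau>")
    case True
    obtain f where "f \<in> B\<^sub>2" "\<forall>j\<in>\<tau> - {i}. the (m j) < f j"
      "\<forall>j\<in>dom m - (\<tau> - {i}). f j < the (m j)"
      using sh(2) t' unfolding shatters_def by blast
    then show ?thesis using True hi[of f] by (intro bexI[of _ f]) auto
  next
    case False
    obtain f where "f \<in> B\<^sub>1" "\<forall>j\<in>\<tau> - {i}. the (m j) < f j"
      "\<forall>j\<in>dom m - (\<tau> - {i}). f j < the (m j)"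
      using sh(1) t' unfolding shatters_def by blast
    then show ?thesis using False lo[of f] i by (intro bexI[of _ f]) auto
  qed
qed

lemma shatters_lower:
  assumes "shatters B m" "m i = Some k" shows "\<exists>f\<in>B. f i < k"
proof -
  obtain f where "f \<in> B" "\<forall>j\<in>dom m - {}. f j < the (m j)"
    using assms(1) unfolding shatters_def by blast
  then show ?thesis using assms(2) by (intro bexI[of _ f]) force+
qed

lemma shatters_upper:
  assumes "shatters B m" "m i = Some k" shows "\<exists>f\<in>B. k < f i"
proof -
  obtain f where "f \<in> B" "\<forall>j\<in>dom m. the (m j) < f j"
    using assms(1) unfolding shatters_def by blast
  then show ?thesis using assms(2) by (intro bexI[of _ f]) force+
qed

text \<open>
A map shattered by both parts is counted twice on the left. It cannot contain the splitting
coordinate \<open>i\<close>: a level there would lie below some value of \<open>B\<^sub>1\<close>, hence below \<open>k\<close>, and above some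
value of \<open>B\<^sub>2\<close>, hence above \<open>k\<close>. Its extension by \<open>i \<mapsto> k\<close> is shattered by \<open>A\<close> but by neither part,
which pays for the second count.
\<close>

lemma card_shattered_maps_split:
  assumes fin: "finite I" "finite V" and i: "i \<in> I" and k: "k \<in> V"
    and sub: "B\<^sub>1 \<subseteq> A" "B\<^sub>2 \<subseteq> A"
    and lo: "\<And>f. f \<in> B\<^sub>1 \<Longrightarrow> f i < k" and hi: "\<And>f. f \<in> B\<^sub>2 \<Longrightarrow> k < f i"
  shows "card (shattered_maps I V B\<^sub>1) + card (shattered_maps I V B\<^sub>2) \<le> card (shattered_maps I V A)"
proof -
  let ?b1 = "shattered_maps I V B\<^sub>1" and ?b2 = "shattered_maps I V B\<^sub>2" and ?u = "\<lambda>m. m(i \<mapsto> k)"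
  have f: "finite ?b1" "finite ?b2" "finite (shattered_maps I V A)" using fin finite_shattered_maps by blast+
  have undef: "m i = None" if m: "m \<in> ?b1 \<inter> ?b2" for m
  proof (rule ccontr)
    assume "m i \<noteq> None"
    then obtain l where l: "m i = Some l" by auto
    from m have s: "shatters B\<^sub>1 m" "shatters B\<^sub>2 m" by (auto simp: shattered_maps_def)
    obtain f g where "f \<in> B\<^sub>1" "l < f i" "g \<in> B\<^sub>2" "g i < l"
      using shatters_upper[OF s(1) l] shatters_lower[OF s(2) l] by blast
    then show False using lo[of f] hi[of g] by linarith
  qed
  have inj: "inj_on ?u (?b1 \<inter> ?b2)"
  proof (rule inj_onI)
    fix m m' assume h: "m \<in> ?b1 \<inter> ?b2" "m' \<in> ?b1 \<inter> ?b2" "?u m = ?u m'"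
    show "m = m'"
    proof
      fix j show "m j = m' j" using fun_cong[OF h(3), of j] undef[OF h(1)] undef[OF h(2)]
        by (cases "j = i") auto
    qed
  qed
  have new: "?u m \<in> shattered_maps I V A" if m: "m \<in> ?b1 \<inter> ?b2" for m
  proof -
    have "shatters (B\<^sub>1 \<union> B\<^sub>2) (?u m)"
      using m undef[OF m] lo hi by (intro shatters_upd) (auto simp: shattered_maps_def)
    then have "shatters A (?u m)" using sub by (blast intro: shatters_mono)
    moreover have "?u m \<in> partial_maps I V"
      using m undef[OF m] i k by (auto simp: shattered_maps_def partial_maps_def)
    ultimately show ?thesis by (simp add: shattered_maps_def)
  qed
  have disj: "(?b1 \<union> ?b2) \<inter> ?u ` (?b1 \<inter> ?b2) = {}"
  proof -
    have "?u m \<notin> ?b1" for m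
      using shatters_upper[of B\<^sub>1 "?u m" i k] lo by (fastforce simp: shattered_maps_def)
    moreover have "?u m \<notin> ?b2" for m
      using shatters_lower[of B\<^sub>2 "?u m" i k] hi by (fastforce simp: shattered_maps_def)
    ultimately show ?thesis by blast
  qed
  have "card ?b1 + card ?b2 = card (?b1 \<union> ?b2) + card (?b1 \<inter> ?b2)"
    using f card_Un_Int by blast
  also have "\<dots> = card (?b1 \<union> ?b2) + card (?u ` (?b1 \<inter> ?b2))"
    using inj by (simp add: card_image)
  also have "\<dots> = card ((?b1 \<union> ?b2) \<union> ?u ` (?b1 \<inter> ?b2))"
    using f disj by (intro card_Un_disjoint[symmetric]) auto
  also have "\<dots> \<le> card (shattered_maps I V A)"
  proof (rule card_mono[OF f(3)])
    have "?b1 \<union> ?b2 \<subseteq> shattered_maps I V A"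
      using sub by (auto simp: shattered_maps_def intro: shatters_mono)
    then show "?b1 \<union> ?b2 \<union> ?u ` (?b1 \<inter> ?b2) \<subseteq> shattered_maps I V A" using new by blast
  qed
  finally show ?thesis .
qed

text \<open>
Splitting again and again produces a binary tree, and the shattered maps are at least as numerous
as its leaves. The condition on \<open>\<theta>\<close> says that \<open>N\<^sup>\<theta>\<close> is subadditive along each split, so that the
bound survives the induction even when one of the two parts is a tiny fraction \<open>\<delta>\<close> of the set.
\<close>

lemma powr_card_le_card_shattered_maps:
  fixes \<delta> \<theta> :: real
  assumes fin: "finite I" "finite V" and "finite A" "A \<noteq> {}"
    and \<delta>: "0 < \<delta>" and \<theta>: "0 \<le> \<theta>" "1 \<le> (1 / 2) powr \<theta> + \<delta> powr \<theta>"
    and split: "\<And>B. B \<subseteq> A \<Longrightarrow> 2 \<le> card B \<Longrightarrow> \<exists>i\<in>I. \<exists>k\<in>V. \<exists>\<alpha> \<beta>.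
      (\<alpha> = 1 / 2 \<and> \<beta> = \<delta> \<or> \<alpha> = \<delta> \<and> \<beta> = 1 / 2) \<and>
      \<alpha> * real (card B) \<le> real (card {f \<in> B. f i < k}) \<and>
      \<beta> * real (card B) \<le> real (card {f \<in> B. k < f i})"
  shows "real (card A) powr \<theta> \<le> real (card (shattered_maps I V A))"
  using assms(3,4) split
proof (induction "card A" arbitrary: A rule: less_induct)
  case less
  show ?case
  proof (cases "2 \<le> card A")
    case False
    have "0 < card A" using less.prems(1,2) by (simp add: card_gt_0_iff)
    then have "card A = 1" using False by simp
    moreover have "Map.empty \<in> shattered_maps I V A"
      using less.prems(2) by (auto simp: shattered_maps_def partial_maps_def shatters_def)
    then have "1 \<le> card (shattered_maps I V A)"
      using finite_shattered_maps[OF fin] by (metis One_nat_def Suc_leI card_gt_0_iff empty_iff)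
    ultimately show ?thesis by simp
  next
    case True
    then obtain i k \<alpha> \<beta> where ik: "i \<in> I" "k \<in> V"
      and ab: "\<alpha> = 1 / 2 \<and> \<beta> = \<delta> \<or> \<alpha> = \<delta> \<and> \<beta> = 1 / 2"
      and lo: "\<alpha> * real (card A) \<le> real (card {f \<in> A. f i < k})"
      and hi: "\<beta> * real (card A) \<le> real (card {f \<in> A. k < f i})"
      using less.prems(3)[of A] by blast
    let ?L = "{f \<in> A. f i < k}" and ?H = "{f \<in> A. k < f i}"
    have pos: "0 < \<alpha>" "0 < \<beta>" using ab \<delta> by auto
    have sum: "1 \<le> \<alpha> powr \<theta> + \<beta> powr \<theta>"
      using ab
    proof
      assume h: "\<alpha> = 1 / 2 \<and> \<beta> = \<delta>"
      show ?thesis unfolding h[THEN conjunct1] h[THEN conjunct2] by (rule \<theta>)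
    next
      assume h: "\<alpha> = \<delta> \<and> \<beta> = 1 / 2"
      show ?thesis unfolding h[THEN conjunct1] h[THEN conjunct2] using \<theta>(2)
        by (simp only: add.commute)
    qed
    have N: "0 < real (card A)" using True by simp
    have "0 < real (card ?L)" "0 < real (card ?H)"
      using less_le_trans[OF mult_pos_pos[OF pos(1) N] lo]
        less_le_trans[OF mult_pos_pos[OF pos(2) N] hi] .
    then have ne: "?L \<noteq> {}" "?H \<noteq> {}" by (auto simp: card_gt_0_iff)
    have step: "real (card B) powr \<theta> \<le> real (card (shattered_maps I V B))" 
      if B: "B \<subset> A" "B \<noteq> {}" for B
    proof (rule less.hyps)
      show "card B < card A" using B less.prems(1) by (simp add: psubset_card_mono)
      show "finite B" "B \<noteq> {}" using B less.prems(1) by (auto intro: finite_subset)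
      fix B' assume "B' \<subseteq> B" "2 \<le> card B'"
      then show "\<exists>i\<in>I. \<exists>k\<in>V. \<exists>\<alpha> \<beta>.
          (\<alpha> = 1 / 2 \<and> \<beta> = \<delta> \<or> \<alpha> = \<delta> \<and> \<beta> = 1 / 2) \<and>
          \<alpha> * real (card B') \<le> real (card {f \<in> B'. f i < k}) \<and>
          \<beta> * real (card B') \<le> real (card {f \<in> B'. k < f i})"
        using B by (intro less.prems(3)) auto
    qed
    have "real (card A) powr \<theta> \<le> (\<alpha> powr \<theta> + \<beta> powr \<theta>) * real (card A) powr \<theta>"
      using mult_right_mono[OF sum, of "real (card A) powr \<theta>"] by simp
    also have "\<dots> = (\<alpha> * real (card A)) powr \<theta> + (\<beta> * real (card A)) powr \<theta>"
      using pos N by (simp add: powr_mult algebra_simps)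
    also have "\<dots> \<le> real (card ?L) powr \<theta> + real (card ?H) powr \<theta>"
      using lo hi pos \<theta> by (intro add_mono powr_mono2) auto
    also have "\<dots> \<le> real (card (shattered_maps I V ?L)) + real (card (shattered_maps I V ?H))"
    proof (intro add_mono step)
      show "?L \<noteq> {}" "?H \<noteq> {}" by (rule ne)+
      obtain f g where "f \<in> ?L" "g \<in> ?H" using ne by blast
      then have "f \<in> A - ?H" "g \<in> A - ?L" by auto
      then show "?L \<subset> A" "?H \<subset> A" by blast+
    qed
    also have "\<dots> \<le> real (card (shattered_maps I V A))"
    proof -
      have "card (shattered_maps I V ?L) + card (shattered_maps I V ?H) \<le> card (shattered_maps I V A)"
        by (rule card_shattered_maps_split[OF fin ik]) auto
      then show ?thesis by linarith
    qed
    finally show ?thesis .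
  qed
qed

section \<open>Families of far apart functions split\<close>

lemma median_exists:
  fixes X :: "'a \<Rightarrow> int"
  assumes "finite B" "B \<noteq> {}"
  obtains q where "q \<in> X ` B" "card B \<le> 2 * card {f \<in> B. X f \<le> q}"
    "card B \<le> 2 * card {f \<in> B. q \<le> X f}"
proof -
  let ?Q = "{q \<in> X ` B. card B \<le> 2 * card {f \<in> B. X f \<le> q}}"
  have "{f \<in> B. X f \<le> Max (X ` B)} = B" using assms by auto
  moreover have "Max (X ` B) \<in> X ` B" using assms by (intro Max_in) auto
  ultimately have "Max (X ` B) \<in> ?Q" by simp
  then have ne: "?Q \<noteq> {}" by blast
  have finQ: "finite ?Q" using assms by auto
  define q where "q = Min ?Q"
  have q: "q \<in> ?Q" unfolding q_def using Min_in[OF finQ ne] .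
  have "card B \<le> 2 * card {f \<in> B. q \<le> X f}"
  proof (rule ccontr)
    assume a: "\<not> ?thesis"
    let ?S = "{f \<in> B. X f < q}"
    have "card B = card ?S + card {f \<in> B. q \<le> X f}"
      using assms by (subst card_Un_disjoint[symmetric]) (auto intro: arg_cong[where f=card])
    then have big: "card B < 2 * card ?S" using a by simp
    then have ne': "?S \<noteq> {}" by (metis card.empty mult_0_right not_less_zero)
    define r where "r = Max (X ` ?S)"
    have r: "r \<in> X ` ?S" unfolding r_def using assms ne' by (intro Max_in) auto
    have "?S \<subseteq> {f \<in> B. X f \<le> r}" unfolding r_def using assms by auto
    then have "card ?S \<le> card {f \<in> B. X f \<le> r}" using assms by (intro card_mono) auto
    then have "r \<in> ?Q" using big r by auto
    then have "q \<le> r" unfolding q_def using finQ by simp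
    then show False using r by auto
  qed
  then show ?thesis using q that by auto
qed

text \<open>
On average over the coordinates a pair differs by at least 3 with probability \<open>\<mu> / 2\<close> (the factor
accounts for the pairs \<open>f = g\<close>), so some coordinate does at least as well. Cutting next to the
median there leaves one half of the family on one side and, on the other side, at least a fraction
\<open>\<mu> / 8\<close>, because a value far from the median occurs with probability \<open>\<mu> / 4\<close>, above or below.
\<close>

lemma far_pairs_split:
  fixes \<mu> :: real and lo hi :: int
  assumes fin: "finite I" "finite B" and B: "2 \<le> card B" and \<mu>: "0 < \<mu>"
    and range: "\<And>f i. f \<in> B \<Longrightarrow> i \<in> I \<Longrightarrow> f i \<in> {lo..hi}"
    and far: "\<And>f g. f \<in> B \<Longrightarrow> g \<in> B \<Longrightarrow> f \<noteq> g \<Longrightarrow>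
      \<mu> * real (card I) < real (card {i \<in> I. 3 \<le> \<bar>f i - g i\<bar>})"
  shows "\<exists>i\<in>I. \<exists>k\<in>{lo..hi}. \<exists>\<alpha> \<beta>.
      (\<alpha> = 1 / 2 \<and> \<beta> = \<mu> / 8 \<or> \<alpha> = \<mu> / 8 \<and> \<beta> = 1 / 2) \<and>
      \<alpha> * real (card B) \<le> real (card {f \<in> B. f i < k}) \<and>
      \<beta> * real (card B) \<le> real (card {f \<in> B. k < f i})"
proof -
  define N where "N = real (card B)"
  define P where "P i = {z \<in> B \<times> B. 3 \<le> \<bar>fst z i - snd z i\<bar>}" for i
  have N: "2 \<le> N" unfolding N_def using B by simp
  have finP: "finite (P i)" for i unfolding P_def using fin by auto
  \<comment> \<open>Double counting of triples \<open>(i, f, g)\<close> with \<open>\<bar>f i - g i\<bar> \<ge> 3\<close>.\<close>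
  obtain i where i: "i \<in> I" "\<mu> / 2 * N\<^sup>2 \<le> real (card (P i))"
  proof (rule ccontr)
    assume "\<not> thesis"
    then have small: "real (card (P i)) \<le> \<mu> / 2 * N\<^sup>2" if "i \<in> I" for i
      using that \<open>(\<And>i. i \<in> I \<Longrightarrow> \<mu> / 2 * N\<^sup>2 \<le> real (card (P i)) \<Longrightarrow> thesis)\<close> by force
    let ?D = "{z \<in> B \<times> B. fst z \<noteq> snd z}"
    have finD: "finite ?D" using fin by auto
    have "?D = B \<times> B - (\<lambda>f. (f, f)) ` B" by auto
    then have "card ?D = card (B \<times> B) - card ((\<lambda>f. (f, f)) ` B)"
      using fin by (subst card_Diff_subset[symmetric]) auto
    also have "card ((\<lambda>f. (f, f)) ` B) = card B" by (intro card_image inj_onI) auto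
    finally have D: "card ?D = card B * card B - card B" by (simp add: card_cartesian_product)
    have D': "real (card ?D) = N * (N - 1)"
      unfolding D N_def by (simp add: of_nat_diff algebra_simps)
    moreover have "0 < N * (N - 1)" using N by (intro mult_pos_pos) auto
    ultimately have Dpos: "0 < card ?D" by simp
    have "N * (N - 1) * (\<mu> * real (card I)) = (\<Sum>z\<in>?D. \<mu> * real (card I))"
      by (simp add: D')
    also have "\<dots> < (\<Sum>z\<in>?D. real (card {i \<in> I. 3 \<le> \<bar>fst z i - snd z i\<bar>}))"
      using finD Dpos far by (intro sum_strict_mono) (auto simp: card_gt_0_iff)
    also have "\<dots> \<le> (\<Sum>z\<in>B \<times> B. real (card {i \<in> I. 3 \<le> \<bar>fst z i - snd z i\<bar>}))"
      using fin by (intro sum_mono2) auto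
    also have "\<dots> = (\<Sum>z\<in>B \<times> B. \<Sum>i\<in>I. of_bool (3 \<le> \<bar>fst z i - snd z i\<bar>))"
      using fin by (intro sum.cong) (auto simp: Int_def intro!: arg_cong[where f=card])
    also have "\<dots> = (\<Sum>i\<in>I. \<Sum>z\<in>B \<times> B. of_bool (3 \<le> \<bar>fst z i - snd z i\<bar>))"
      by (rule sum.swap)
    also have "\<dots> = (\<Sum>i\<in>I. real (card (P i)))"
      using fin by (intro sum.cong) (auto simp: P_def Int_def intro!: arg_cong[where f=card])
    also have "\<dots> \<le> (\<Sum>i\<in>I. \<mu> / 2 * N\<^sup>2)" using small by (intro sum_mono) auto
    also have "\<dots> = real (card I) * (\<mu> / 2 * N\<^sup>2)" by simp
    finally have "(N * (N - 1)) * (\<mu> * real (card I)) < N\<^sup>2 / 2 * (\<mu> * real (card I))"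
      by (simp add: mult_ac)
    then have "N * (N - 1) < N\<^sup>2 / 2"
      using \<mu> by (meson mult_nonneg_nonneg mult_right_mono not_le of_nat_0_le_iff less_imp_le)
    moreover have "N * 2 \<le> N * N" using N by (intro mult_left_mono) auto
    ultimately show False by (simp add: power2_eq_square algebra_simps)
  qed
  have "B \<noteq> {}" using B by auto
  then obtain q where q: "q \<in> (\<lambda>f. f i) ` B" "card B \<le> 2 * card {f \<in> B. f i \<le> q}"
    "card B \<le> 2 * card {f \<in> B. q \<le> f i}"
    by (rule median_exists[OF fin(2)])
  let ?L = "{f \<in> B. f i \<le> q - 2}" and ?H = "{f \<in> B. q + 2 \<le> f i}"
  \<comment> \<open>Two values at distance at least 3 cannot both lie within distance 1 of the median.\<close>
  have "P i \<subseteq> (?L \<union> ?H) \<times> B \<union> B \<times> (?L \<union> ?H)" unfolding P_def by auto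
  then have "card (P i) \<le> card ((?L \<union> ?H) \<times> B \<union> B \<times> (?L \<union> ?H))"
    using fin by (intro card_mono) auto
  also have "\<dots> \<le> card ((?L \<union> ?H) \<times> B) + card (B \<times> (?L \<union> ?H))" by (rule card_Un_le)
  also have "\<dots> = 2 * card B * card (?L \<union> ?H)" by (simp add: card_cartesian_product)
  also have "\<dots> \<le> 2 * card B * (card ?L + card ?H)"
    by (intro mult_left_mono card_Un_le) auto
  finally have "real (card (P i)) \<le> real (2 * card B * (card ?L + card ?H))"
    by (rule of_nat_mono)
  then have "N * (\<mu> / 2 * N) \<le> N * (2 * (real (card ?L) + real (card ?H)))"
    using i(2) unfolding N_def by (simp add: power2_eq_square algebra_simps)
  then have LH: "\<mu> / 4 * N \<le> real (card ?L) + real (card ?H)"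
    using N by (simp add: mult_le_cancel_left)
  have pos: "0 < \<mu> / 8 * N" using N \<mu> by simp
  have qr: "q \<in> {lo..hi}" using q(1) range i(1) by auto
  show ?thesis
  proof (cases "\<mu> / 8 * N \<le> real (card ?L)")
    case True
    then have "?L \<noteq> {}" using pos by (metis card.empty not_le of_nat_0)
    then obtain f where "f \<in> B" "f i \<le> q - 2" by auto
    then have k: "q - 1 \<in> {lo..hi}" using range[of f i] i(1) qr by auto
    have e: "{f \<in> B. f i < q - 1} = ?L" "{f \<in> B. q - 1 < f i} = {f \<in> B. q \<le> f i}" by auto
    show ?thesis
    proof (rule bexI[of _ i], rule bexI[of _ "q - 1"], rule exI[of _ "\<mu> / 8"],
        rule exI[of _ "1 / 2 :: real"], intro conjI)
      show "1 / 2 * real (card B) \<le> real (card {f \<in> B. q - 1 < f i})"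
        unfolding e using q(3) by simp
      show "\<mu> / 8 * real (card B) \<le> real (card {f \<in> B. f i < q - 1})"
        unfolding e using True by (simp add: N_def)
    qed (use k i in auto)
  next
    case False
    then have H: "\<mu> / 8 * N \<le> real (card ?H)" using LH by (simp add: field_simps)
    then have "?H \<noteq> {}" using pos by (metis card.empty not_le of_nat_0)
    then obtain f where "f \<in> B" "q + 2 \<le> f i" by auto
    then have k: "q + 1 \<in> {lo..hi}" using range[of f i] i(1) qr by auto
    have e: "{f \<in> B. f i < q + 1} = {f \<in> B. f i \<le> q}" "{f \<in> B. q + 1 < f i} = ?H" by auto
    show ?thesis
    proof (rule bexI[of _ i], rule bexI[of _ "q + 1"], rule exI[of _ "1 / 2 :: real"],
        rule exI[of _ "\<mu> / 8"], intro conjI)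
      show "1 / 2 * real (card B) \<le> real (card {f \<in> B. f i < q + 1})"
        unfolding e using q(2) by simp
      show "\<mu> / 8 * real (card B) \<le> real (card {f \<in> B. q + 1 < f i})"
        unfolding e using H by (simp add: N_def)
    qed (use k i in auto)
  qed
qed

section \<open>Separation in one coordinate gives separation in many\<close>

lemma maximal_separated_subset:
  assumes bound: "\<And>A. finite A \<Longrightarrow> A \<subseteq> K \<Longrightarrow>
      (\<And>x y. x \<in> A \<Longrightarrow> y \<in> A \<Longrightarrow> x \<noteq> y \<Longrightarrow> \<not> close x y) \<Longrightarrow> card A \<le> b"
    and refl: "\<And>x. x \<in> K \<Longrightarrow> close x x"
    and sym: "\<And>x y. close x y \<Longrightarrow> close y x"
  obtains A where "finite A" "A \<subseteq> K"
    "\<And>x y. x \<in> A \<Longrightarrow> y \<in> A \<Longrightarrow> x \<noteq> y \<Longrightarrow> \<not> close x y"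
    "\<And>x. x \<in> K \<Longrightarrow> \<exists>a\<in>A. close x a"
proof -
  define P where "P A \<longleftrightarrow> finite A \<and> A \<subseteq> K \<and>
    (\<forall>x\<in>A. \<forall>y\<in>A. x \<noteq> y \<longrightarrow> \<not> close x y)" for A
  have "P {}" by (simp add: P_def)
  moreover have "card A \<le> b" if "P A" for A
  proof (rule bound)
    show "finite A" "A \<subseteq> K" using that by (auto simp: P_def)
    show "\<not> close x y" if "x \<in> A" "y \<in> A" "x \<noteq> y" for x y
      using \<open>P A\<close> that by (simp add: P_def)
  qed
  ultimately have "\<exists>A. P A \<and> (\<forall>A'. P A' \<longrightarrow> card A' \<le> card A)"
    by (intro ex_has_greatest_nat[where k = "{}" and b = "Suc b"]) (auto simp: less_Suc_eq_le)
  then obtain A where A: "P A" "\<And>A'. P A' \<Longrightarrow> card A' \<le> card A" by blast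
  have "\<exists>a\<in>A. close x a" if x: "x \<in> K" for x
  proof (rule ccontr)
    assume far: "\<not> ?thesis"
    then have "x \<notin> A" using refl[OF x] by blast
    have "P (insert x A)" using A(1) x far sym unfolding P_def by blast
    then have "card (insert x A) \<le> card A" by (rule A(2))
    then show False using A(1) \<open>x \<notin> A\<close> by (simp add: P_def)
  qed
  with A(1) show ?thesis unfolding P_def by (intro that[of A]) auto
qed

text \<open>
Take \<open>A'\<close> maximal. Every member of \<open>A\<close> then differs by at least 3 from some \<open>g \<in> A'\<close> in at most
\<open>\<mu> n\<close> coordinates only. Given \<open>g\<close>, it is determined by those coordinates and its values there: two
members with the same data differ by at most \<open>2 + 2 < 5\<close> everywhere. Hence the balls around the
members of \<open>A'\<close> are no larger than the number of partial maps of domain size at most \<open>\<mu> n\<close>.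
\<close>

lemma far_subset_exists:
  fixes \<mu> :: real and lo hi :: int
  assumes fin: "finite I" "finite A" and \<mu>: "0 < \<mu>" "\<mu> \<le> 1" and b: "lo \<le> hi"
    and range: "\<And>f i. f \<in> A \<Longrightarrow> i \<in> I \<Longrightarrow> f i \<in> {lo..hi}"
    and sep: "\<And>f g. f \<in> A \<Longrightarrow> g \<in> A \<Longrightarrow> f \<noteq> g \<Longrightarrow> \<exists>i\<in>I. 5 \<le> \<bar>f i - g i\<bar>"
  obtains A' where "A' \<subseteq> A"
    "\<And>f g. f \<in> A' \<Longrightarrow> g \<in> A' \<Longrightarrow> f \<noteq> g \<Longrightarrow>
      \<mu> * real (card I) < real (card {i \<in> I. 3 \<le> \<bar>f i - g i\<bar>})"
    "real (card A) \<le> real (card A') *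
      exp (\<mu> * real (card I) * (ln (real (card {lo..hi}) / \<mu>) + 1))"
proof -
  define close where "close f g \<longleftrightarrow> real (card {i \<in> I. 3 \<le> \<bar>f i - g i\<bar>}) \<le> \<mu> * real (card I)"
    for f g :: "'a \<Rightarrow> int"
  obtain A' where A': "finite A'" "A' \<subseteq> A" "\<And>f g. f \<in> A' \<Longrightarrow> g \<in> A' \<Longrightarrow> f \<noteq> g \<Longrightarrow> \<not> close f g"
    "\<And>f. f \<in> A \<Longrightarrow> \<exists>g\<in>A'. close f g"
  proof (rule maximal_separated_subset[of A close "card A"])
    show "close f f" for f using \<mu> by (simp add: close_def)
    show "close g f" if "close f g" for f g
      using that by (simp add: close_def abs_minus_commute)
  qed (use fin in \<open>auto intro: card_mono\<close>)
  let ?B = "real (card {lo..hi})"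
  let ?E = "exp (\<mu> * real (card I) * (ln (?B / \<mu>) + 1))"
  have B: "1 \<le> ?B" using b by simp
  have ball: "real (card {f \<in> A. close f g}) \<le> ?E" for g
  proof -
    let ?S = "{m \<in> partial_maps I {lo..hi}. real (card (dom m)) \<le> \<mu> * real (card I)}"
    define r where "r f = (\<lambda>i. if i \<in> I \<and> 3 \<le> \<bar>f i - g i\<bar> then Some (f i) else None)"
      for f :: "'a \<Rightarrow> int"
    have dom: "dom (r f) = {i \<in> I. 3 \<le> \<bar>f i - g i\<bar>}" for f
      by (auto simp: r_def split: if_splits)
    have "inj_on r {f \<in> A. close f g}"
    proof (rule inj_onI, rule ccontr)
      fix f f' assume h: "f \<in> {f \<in> A. close f g}" "f' \<in> {f \<in> A. close f g}" "r f = r f'" "f \<noteq> f'"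
      then obtain i where "i \<in> I" "5 \<le> \<bar>f i - f' i\<bar>" using sep by blast
      then show False using fun_cong[OF h(3), of i] by (auto simp: r_def split: if_splits)
    qed
    moreover have "r ` {f \<in> A. close f g} \<subseteq> ?S"
    proof (rule image_subsetI)
      fix f assume f: "f \<in> {f \<in> A. close f g}"
      have "ran (r f) \<subseteq> {lo..hi}"
        using f range by (force simp: r_def ran_def split: if_splits)
      then show "r f \<in> ?S" using f by (auto simp: partial_maps_def dom close_def)
    qed
    moreover have "finite ?S" using finite_partial_maps[OF fin(1), of "{lo..hi}"] by simp
    ultimately have "card {f \<in> A. close f g} \<le> card ?S" by (rule card_inj_on_le)
    then have "real (card {f \<in> A. close f g}) \<le> real (card ?S)" by simp
    also have "\<dots> \<le> exp (\<mu> * real (card I) * ln (1 / (\<mu> / ?B)) + real (card I) * ?B * (\<mu> / ?B))"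
      using \<mu> B fin by (intro card_partial_maps_le) (auto simp: divide_le_eq)
    also have "\<dots> = ?E"
    proof -
      have "?B \<noteq> 0" using B by linarith
      then show ?thesis by (simp add: algebra_simps del: card_atLeastAtMost_int)
    qed
    finally show ?thesis .
  qed
  have "A = (\<Union>g\<in>A'. {f \<in> A. close f g})" using A'(4) by auto
  then have "card A \<le> (\<Sum>g\<in>A'. card {f \<in> A. close f g})"
    using card_UN_le[OF A'(1), of "\<lambda>g. {f \<in> A. close f g}"] by simp
  then have "real (card A) \<le> real (\<Sum>g\<in>A'. card {f \<in> A. close f g})" by (rule of_nat_mono)
  also have "\<dots> = (\<Sum>g\<in>A'. real (card {f \<in> A. close f g}))" by simp
  also have "\<dots> \<le> (\<Sum>g\<in>A'. ?E)" using ball by (intro sum_mono) auto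
  finally have "real (card A) \<le> real (card A') * ?E" by simp
  moreover have "\<mu> * real (card I) < real (card {i \<in> I. 3 \<le> \<bar>f i - g i\<bar>})"
    if "f \<in> A'" "g \<in> A'" "f \<noteq> g" for f g
    using A'(3)[OF that] by (simp add: close_def)
  ultimately show ?thesis using that[of A'] A'(2) by blast
qed

section \<open>Entropy and shattered dimension\<close>

text \<open>
Since \<open>ln y \<le> 2 \<surd>y\<close>, the hypothesis is a quadratic inequality for \<open>\<surd>y\<close>.
\<close>

lemma log_self_bound:
  fixes v y :: real
  assumes "0 < y" "0 \<le> v" "y \<le> 40 * v * (ln y + 7 * v)"
  shows "y \<le> 7000 * v\<^sup>2"
proof -
  define s where "s = sqrt y"
  have s: "0 < s" "y = s\<^sup>2" using assms by (simp_all add: s_def)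
  have "ln y = 2 * ln s" using s by (simp add: ln_realpow)
  also have "\<dots> \<le> 2 * s" using s ln_le_minus_one[of s] by simp
  finally have "40 * v * (ln y + 7 * v) \<le> 40 * v * (2 * s + 7 * v)"
    using assms by (intro mult_left_mono) auto
  then have "s\<^sup>2 \<le> 80 * v * s + 280 * v\<^sup>2"
    using assms s by (simp add: algebra_simps power2_eq_square)
  moreover have "0 \<le> (s - 80 * v)\<^sup>2" by simp
  ultimately have "s\<^sup>2 \<le> 6960 * v\<^sup>2" by (simp add: power2_diff algebra_simps power2_eq_square)
  also have "\<dots> \<le> 7000 * v\<^sup>2" by simp
  finally show ?thesis using s by simp
qed

text \<open>
The main estimate for integer-valued functions. With \<open>v = M ln u\<close> and \<open>\<mu> = exp (- 7 v)\<close>, passing to a far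
apart subfamily costs at most a square root of the cardinality. This is where \<open>large\<close> enters for
the first time: it makes \<open>\<mu> n (ln (b / \<mu>) + 1)\<close> small against \<open>ln (card A)\<close>. The subfamily splits with
\<open>\<delta> = \<mu> / 8\<close>, which allows the exponent \<open>\<theta> = 1 / (20 v)\<close>, and so \<open>L = ln (card A)\<close> is at most \<open>40 v\<close> times the logarithm
of the number of shattered maps. Counting these by their domain size, and using \<open>large\<close> again to
replace \<open>n\<close> by \<open>L exp v\<close>, gives a self-referential bound for \<open>L / D\<close>, with \<open>D\<close> the largest domain size.
\<close>

lemma ln_card_le_shatter_dim:
  fixes A :: "('i \<Rightarrow> int) set" and lo hi :: int and u M :: real
  assumes fin: "finite I" "finite A" and A: "2 \<le> card A"
    and range: "\<And>f i. f \<in> A \<Longrightarrow> i \<in> I \<Longrightarrow> f i \<in> {lo..hi}"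
    and sep: "\<And>f g. f \<in> A \<Longrightarrow> g \<in> A \<Longrightarrow> f \<noteq> g \<Longrightarrow> \<exists>i\<in>I. 5 \<le> \<bar>f i - g i\<bar>"
    and u: "2 \<le> u" and M: "1 \<le> M" and b: "real (card {lo..hi}) \<le> 6 * u"
    and large: "real (card I) \<le> u powr M * ln (real (card A))"
    and dim: "\<And>m. m \<in> shattered_maps I {lo..hi} A \<Longrightarrow> card (dom m) \<le> d"
  shows "ln (real (card A)) \<le> 7000 * (M * ln u)\<^sup>2 * real d"
proof -
  define n where "n = real (card I)"
  define L where "L = ln (real (card A))"
  define B where "B = real (card {lo..hi})"
  define v where "v = M * ln u"
  define \<mu> where "\<mu> = exp (- (7 * v))"
  have L: "0 < L" unfolding L_def using A by simp
  have lnu: "2 / 3 \<le> ln u"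
    using ln2_ge_two_thirds u by (meson ln_le_cancel_iff order_trans zero_less_numeral less_le_trans)
  have uv: "ln u \<le> v" unfolding v_def using M lnu mult_right_mono[of 1 M "ln u"] by simp
  have v: "2 / 3 \<le> v" using uv lnu by simp
  have ln2v: "ln 2 \<le> v" using uv u by (meson ln_le_cancel_iff order_trans zero_less_numeral less_le_trans)
  have nL: "n \<le> exp v * L" using large u unfolding n_def L_def v_def powr_def by simp
  \<comment> \<open>Two distinct members exist, so \<open>I\<close> and \<open>{lo..hi}\<close> are nonempty.\<close>
  obtain f g where fg: "f \<in> A" "g \<in> A" "f \<noteq> g" 
    using A fin by (metis card_le_Suc0_iff_eq not_less_eq_eq numeral_2_eq_2)
  then obtain i where i: "i \<in> I" "5 \<le> \<bar>f i - g i\<bar>" using sep by blast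
  have lohi: "lo \<le> hi" using range[OF fg(1) i(1)] by auto
  then have B1: "1 \<le> B" by (simp add: B_def)
  have n1: "1 \<le> n" unfolding n_def using i fin by (metis Suc_leI card_gt_0_iff empty_iff of_nat_1 of_nat_mono One_nat_def)
  have lnB0: "0 \<le> ln B" using B1 by simp
  have lnB: "ln B \<le> 4 * v"
  proof -
    have "ln B \<le> ln (8 * u)" using b B1 u unfolding B_def by (subst ln_le_cancel_iff) auto
    also have "\<dots> = ln (2 ^ 3) + ln u" using u by (simp add: ln_mult)
    also have "\<dots> = 3 * ln 2 + ln u" by (subst ln_realpow) auto
    finally show ?thesis using ln2v uv by simp
  qed
  have \<mu>: "0 < \<mu>" "\<mu> \<le> 1" using v by (simp_all add: \<mu>_def)
  have ln\<mu>: "ln (B / \<mu>) = ln B + 7 * v" using B1 \<mu> by (simp add: ln_div \<mu>_def)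
  obtain A' where A': "A' \<subseteq> A"
    and far: "\<And>f g. f \<in> A' \<Longrightarrow> g \<in> A' \<Longrightarrow> f \<noteq> g \<Longrightarrow>
      \<mu> * real (card I) < real (card {i \<in> I. 3 \<le> \<bar>f i - g i\<bar>})"
    and big: "real (card A) \<le> real (card A') *
      exp (\<mu> * real (card I) * (ln (real (card {lo..hi}) / \<mu>) + 1))"
    by (rule far_subset_exists[OF fin \<mu> lohi]) (use range sep in blast)+
  have finA': "finite A'" using A' fin finite_subset by blast
  have A'pos: "0 < real (card A')" 
    using big A by (cases "card A' = 0") auto
  have half: "\<mu> * n * (ln (B / \<mu>) + 1) \<le> L / 2"
  proof -
    have "32 * v \<le> exp (6 * v)"
    proof -
      \<comment> \<open>\<open>v \<ge> ln 2\<close> gives \<open>exp v \<ge> 2\<close>, and one more factor \<open>exp v\<close> absorbs \<open>v\<close> itself.\<close>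
      have "2 \<le> exp v" using ln2v exp_le_cancel_iff[of "ln 2" v] by simp
      moreover have "v \<le> exp v" using exp_ge_add_one_self[of v] by linarith
      ultimately have "2 ^ 5 * v \<le> exp v ^ 5 * exp v"
        using v by (intro mult_mono power_mono) auto
      also have "\<dots> = exp (6 * v)"
        by (simp add: exp_of_nat_mult[symmetric] exp_add[symmetric])
      finally show ?thesis by simp
    qed
    have "\<mu> * n * (ln (B / \<mu>) + 1) \<le> \<mu> * (exp v * L) * (13 * v)"
      using \<mu> nL n1 ln\<mu> lnB lnB0 v L by (intro mult_mono) auto
    also have "\<dots> = exp (- (6 * v)) * (13 * v) * L"
      unfolding \<mu>_def by (simp add: exp_add[symmetric] mult.assoc[symmetric])
    also have "\<dots> \<le> exp (- (6 * v)) * (exp (6 * v) / 2) * L"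
      using \<open>32 * v \<le> exp (6 * v)\<close> v L by (intro mult_right_mono mult_left_mono) auto
    also have "\<dots> = L / 2" by (simp add: exp_minus)
    finally show ?thesis .
  qed
  have lnA': "L / 2 \<le> ln (real (card A'))"
  proof -
    have "L \<le> ln (real (card A') * exp (\<mu> * n * (ln (B / \<mu>) + 1)))"
      unfolding L_def using big A A'pos by (subst ln_le_cancel_iff) (auto simp: n_def B_def)
    also have "\<dots> = ln (real (card A')) + \<mu> * n * (ln (B / \<mu>) + 1)"
      using A'pos by (simp add: ln_mult)
    finally show ?thesis using half by simp
  qed
  define \<theta> where "\<theta> = 1 / (20 * v)"
  have \<theta>: "0 < \<theta>" using v by (simp add: \<theta>_def)
  have "real (card A') powr \<theta> \<le> real (card (shattered_maps I {lo..hi} A'))"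
  proof (rule powr_card_le_card_shattered_maps[where \<delta> = "\<mu> / 8"])
    show "A' \<noteq> {}" using A'pos by auto
    show "1 \<le> (1 / 2) powr \<theta> + (\<mu> / 8) powr \<theta>"
    proof -
      have "ln (8::real) = 3 * ln 2" using ln_realpow[of 2 3] by simp
      then have "1 / 2 \<le> 1 + \<theta> * ln (\<mu> / 8)"
        using ln2v v \<mu> by (simp add: \<theta>_def ln_div \<mu>_def field_simps)
      also have "\<dots> \<le> exp (\<theta> * ln (\<mu> / 8))" by (rule exp_ge_add_one_self)
      finally have "1 / 2 \<le> (\<mu> / 8) powr \<theta>" using \<mu> by (simp add: powr_def)
      moreover have "1 / 2 \<le> 1 + \<theta> * ln (1 / 2)"
        using ln2v v by (simp add: \<theta>_def ln_div field_simps)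
      then have "1 / 2 \<le> exp (\<theta> * ln (1 / 2))"
        using exp_ge_add_one_self[of "\<theta> * ln (1 / 2)"] by linarith
      then have "1 / 2 \<le> (1 / 2 :: real) powr \<theta>" by (simp add: powr_def)
      ultimately show ?thesis by simp
    qed
    fix C assume C: "C \<subseteq> A'" "2 \<le> card C"
    show "\<exists>i\<in>I. \<exists>k\<in>{lo..hi}. \<exists>\<alpha> \<beta>.
      (\<alpha> = 1 / 2 \<and> \<beta> = \<mu> / 8 \<or> \<alpha> = \<mu> / 8 \<and> \<beta> = 1 / 2) \<and>
      \<alpha> * real (card C) \<le> real (card {f \<in> C. f i < k}) \<and>
      \<beta> * real (card C) \<le> real (card {f \<in> C. k < f i})"
    proof (rule far_pairs_split[OF fin(1) _ C(2) \<mu>(1)])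
      show "finite C" using C finA' finite_subset by blast
      show "f i \<in> {lo..hi}" if "f \<in> C" "i \<in> I" for f i using that C A' range by blast
      show "\<mu> * real (card I) < real (card {i \<in> I. 3 \<le> \<bar>f i - g i\<bar>})"
        if "f \<in> C" "g \<in> C" "f \<noteq> g" for f g using that C far by blast
    qed
  qed (use fin finA' \<mu> \<theta> in auto)
  also have "shattered_maps I {lo..hi} A' \<subseteq> shattered_maps I {lo..hi} A"
    using A' by (auto simp: shattered_maps_def intro: shatters_mono)
  then have "real (card (shattered_maps I {lo..hi} A')) \<le> real (card (shattered_maps I {lo..hi} A))"
    using finite_shattered_maps[OF fin(1)] by (intro of_nat_mono card_mono) auto
  finally have shattered_maps: "real (card A') powr \<theta> \<le> real (card (shattered_maps I {lo..hi} A))" .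
  let ?bx = "shattered_maps I {lo..hi} A"
  have finbx: "finite ?bx" using finite_shattered_maps[OF fin(1)] by auto
  have "0 < real (card A') powr \<theta>" using A'pos by simp
  then have bxpos: "0 < card ?bx" using shattered_maps by linarith
  have "\<theta> * (L / 2) \<le> \<theta> * ln (real (card A'))" using lnA' \<theta> by simp
  also have "\<dots> = ln (real (card A') powr \<theta>)" using A'pos by (simp add: ln_powr)
  also have "\<dots> \<le> ln (real (card ?bx))"
    using shattered_maps A'pos bxpos by (subst ln_le_cancel_iff) auto
  finally have Lbx: "L \<le> 40 * v * ln (real (card ?bx))"
    using v by (simp add: \<theta>_def field_simps)
  define D where "D = Max ((\<lambda>m. card (dom m)) ` ?bx)"
  have nebx: "?bx \<noteq> {}" using bxpos by auto
  have Dmax: "card (dom m) \<le> D" if "m \<in> ?bx" for m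
    unfolding D_def using finbx that by (intro Max_ge) auto
  have "D \<in> (\<lambda>m. card (dom m)) ` ?bx" unfolding D_def using finbx nebx by (intro Max_in) auto
  then obtain m where m: "m \<in> ?bx" "D = card (dom m)" by auto
  have Dd: "D \<le> d" using m dim by simp
  have "D \<le> card I" using m fin by (auto simp: shattered_maps_def partial_maps_def intro: card_mono)
  then have Dn: "real D \<le> n" by (simp add: n_def)
  \<comment> \<open>If only the empty map were shattered, the bound \<open>Lbx\<close> would give \<open>L \<le> 0\<close>.\<close>
  have D0: "0 < D"
  proof (rule ccontr)
    assume "\<not> 0 < D"
    have "?bx \<subseteq> {Map.empty}"
    proof
      fix m assume m: "m \<in> ?bx"
      then have "finite (dom m)" using fin by (auto simp: shattered_maps_def partial_maps_def intro: finite_subset)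
      then show "m \<in> {Map.empty}" using Dmax[OF m] \<open>\<not> 0 < D\<close> by simp
    qed
    then have "card ?bx \<le> card {Map.empty :: 'i \<rightharpoonup> int}" by (intro card_mono) auto
    then have "ln (real (card ?bx)) = 0" using bxpos by (simp add: le_Suc_eq)
    then show False using Lbx L by simp
  qed
  define y where "y = L / real D"
  have y: "0 < y" using L D0 by (simp add: y_def)
  have lnbx: "ln (real (card ?bx)) \<le> real D * (ln y + 7 * v)"
  proof -
    \<comment> \<open>This choice of the weight balances the two terms of the exponent.\<close>
    define x where "x = real D / (n * B)"
    have nB: "n \<le> n * B" using n1 mult_left_mono[OF B1, of n] by simp
    have "real D \<le> n * B" using Dn nB by linarith
    then have x: "0 < x" "x \<le> 1" using D0 n1 B1 by (auto simp: x_def divide_le_eq)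
    have "real (card ?bx) \<le>
        real (card {m \<in> partial_maps I {lo..hi}. real (card (dom m)) \<le> real D})"
      using finite_partial_maps[OF fin(1), of "{lo..hi}"] Dmax
      by (intro of_nat_mono card_mono) (auto simp: shattered_maps_def)
    also have "\<dots> \<le> exp (real D * ln (1 / x) + real (card I) * real (card {lo..hi}) * x)"
      using x fin by (intro card_partial_maps_le) auto
    also have "real (card I) * real (card {lo..hi}) * x = real D"
      unfolding n_def[symmetric] B_def[symmetric] using n1 B1 by (simp add: x_def)
    finally have "ln (real (card ?bx)) \<le> ln (exp (real D * ln (1 / x) + real D))"
      using bxpos by (subst ln_le_cancel_iff) auto
    also have "\<dots> = real D * ln (1 / x) + real D" by simp
    also have "ln (1 / x) \<le> ln (y * exp v * B)"
    proof (subst ln_le_cancel_iff)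
      have "1 / x = n * B / real D" by (simp add: x_def)
      also have "\<dots> \<le> (exp v * L) * B / real D"
        using nL B1 D0 by (intro divide_right_mono mult_right_mono) auto
      finally show "1 / x \<le> y * exp v * B" by (simp add: y_def mult_ac)
    qed (use x y B1 in auto)
    also have "ln (y * exp v * B) = ln y + v + ln B" using y B1 by (simp add: ln_mult)
    also have "real D * (ln y + v + ln B) + real D = real D * (ln y + v + ln B + 1)"
      by (simp add: algebra_simps)
    also have "\<dots> \<le> real D * (ln y + 7 * v)" using lnB v by (intro mult_left_mono) auto
    finally show ?thesis by (simp add: mult_left_mono)
  qed
  have "L \<le> 40 * v * (real D * (ln y + 7 * v))"
    using v by (intro order.trans[OF Lbx] mult_left_mono[OF lnbx]) simp
  then have "y \<le> 40 * v * (ln y + 7 * v)"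
    using D0 by (simp add: y_def divide_le_eq mult_ac)
  then have "y \<le> 7000 * v\<^sup>2" using y v by (intro log_self_bound) auto
  then have "L \<le> 7000 * v\<^sup>2 * real D" using D0 by (simp add: y_def divide_le_eq)
  also have "\<dots> \<le> 7000 * v\<^sup>2 * real d" using Dd by (intro mult_left_mono) auto
  finally show ?thesis by (simp add: L_def v_def)
qed

text \<open>
Rounding at scale \<open>t / 5\<close> turns separation by \<open>t\<close> into separation of the integer parts by 5. An
integer part below the level \<open>m i\<close> comes from a value below \<open>m i t / 5\<close>, one above it from a value of
at least \<open>(m i + 1) t / 5\<close>; so a shattered map leaves gaps of length \<open>t / 5\<close>.
\<close>

lemma ln_card_separated_le:
  fixes A :: "('i \<Rightarrow> real) set" and t M :: real
  assumes fin: "finite I" "finite A" and A: "2 \<le> card A"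
    and range: "\<And>f i. f \<in> A \<Longrightarrow> i \<in> I \<Longrightarrow> \<bar>f i\<bar> \<le> 1"
    and sep: "\<And>f g. f \<in> A \<Longrightarrow> g \<in> A \<Longrightarrow> f \<noteq> g \<Longrightarrow> \<exists>i\<in>I. t \<le> \<bar>f i - g i\<bar>"
    and t: "0 < t" "t \<le> 1" and M: "1 \<le> M"
    and large: "real (card I) \<le> (2 / t) powr M * ln (real (card A))"
    and dim: "\<And>\<sigma> x. \<sigma> \<subseteq> I \<Longrightarrow> (\<And>\<tau>. \<tau> \<subseteq> \<sigma> \<Longrightarrow>
      \<exists>f\<in>A. (\<forall>i\<in>\<tau>. x i + t / 5 \<le> f i) \<and> (\<forall>i\<in>\<sigma> - \<tau>. f i \<le> x i)) \<Longrightarrow> card \<sigma> \<le> d"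
  shows "ln (real (card A)) \<le> 7000 * (M * ln (2 / t))\<^sup>2 * real d"
proof -
  define r where "r f = (\<lambda>i. \<lfloor>5 * f i / t\<rfloor>)" for f :: "'i \<Rightarrow> real"
  have gap: "\<exists>i\<in>I. 5 \<le> \<bar>r f i - r g i\<bar>" if fg: "f \<in> A" "g \<in> A" "f \<noteq> g" for f g
  proof -
    obtain i where i: "i \<in> I" "t \<le> \<bar>f i - g i\<bar>" using sep[OF fg] by blast
    have "5 \<le> \<bar>5 * f i / t - 5 * g i / t\<bar>"
    proof -
      have "5 * f i / t - 5 * g i / t = 5 * (f i - g i) / t"
        by (simp add: right_diff_distrib diff_divide_distrib)
      then show ?thesis using i(2) t by (simp add: abs_mult le_divide_eq)
    qed
    then have "5 \<le> \<bar>r f i - r g i\<bar>" unfolding r_def by linarith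
    then show ?thesis using i(1) by blast
  qed
  have inj: "inj_on r A"
  proof (rule inj_onI, rule ccontr)
    fix f g assume "f \<in> A" "g \<in> A" "r f = r g" "f \<noteq> g"
    then show False using gap[of f g] by simp
  qed
  let ?lo = "\<lfloor>- 5 / t\<rfloor>" and ?hi = "\<lfloor>5 / t\<rfloor>"
  have "ln (real (card (r ` A))) \<le> 7000 * (M * ln (2 / t))\<^sup>2 * real d"
  proof (rule ln_card_le_shatter_dim[where I = I and lo = "?lo" and hi = "?hi"])
    show "2 \<le> card (r ` A)" using A inj by (simp add: card_image)
    show "k i \<in> {?lo..?hi}" if "k \<in> r ` A" "i \<in> I" for k i
    proof -
      obtain f where f: "f \<in> A" "k = r f" using \<open>k \<in> r ` A\<close> by blast
      have "- 5 / t \<le> 5 * f i / t" "5 * f i / t \<le> 5 / t"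
        using range[OF f(1) that(2)] t by (intro divide_right_mono; simp add: abs_le_iff)+
      then show ?thesis unfolding f(2) r_def by (auto intro: floor_mono)
    qed
    show "\<exists>i\<in>I. 5 \<le> \<bar>k i - l i\<bar>" if "k \<in> r ` A" "l \<in> r ` A" "k \<noteq> l" for k l
      using that gap by blast
    show "real (card {?lo..?hi}) \<le> 6 * (2 / t)"
    proof -
      have "?lo \<le> ?hi" using t by (intro floor_mono divide_right_mono) auto
      then have "real (card {?lo..?hi}) = of_int ?hi - of_int ?lo + 1" by simp
      moreover have "of_int ?hi \<le> 5 / t" "- 5 / t < of_int ?lo + 1" by linarith+
      ultimately have "real (card {?lo..?hi}) \<le> 5 / t - - 5 / t + 2" by linarith
      also have "\<dots> \<le> 6 * (2 / t)" using t by (simp add: field_simps)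
      finally show ?thesis .
    qed
    show "2 \<le> 2 / t" using t by (simp add: le_divide_eq)
    show "real (card I) \<le> (2 / t) powr M * ln (real (card (r ` A)))"
      using large inj by (simp add: card_image)
    fix m assume m: "m \<in> shattered_maps I {?lo..?hi} (r ` A)"
    show "card (dom m) \<le> d"
    proof (rule dim)
      show "dom m \<subseteq> I" using m by (auto simp: shattered_maps_def partial_maps_def)
      fix \<tau> assume "\<tau> \<subseteq> dom m"
      then obtain f where f: "f \<in> A" "\<forall>i\<in>\<tau>. the (m i) < r f i"
        "\<forall>i\<in>dom m - \<tau>. r f i < the (m i)"
        using m unfolding shattered_maps_def shatters_def by blast
      show "\<exists>f\<in>A. (\<forall>i\<in>\<tau>. of_int (the (m i)) * t / 5 + t / 5 \<le> f i) \<and>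
          (\<forall>i\<in>dom m - \<tau>. f i \<le> of_int (the (m i)) * t / 5)"
      proof (intro bexI[OF _ f(1)] conjI ballI)
        fix i assume "i \<in> \<tau>"
        then have "of_int (the (m i)) + 1 \<le> 5 * f i / t"
          using f(2) unfolding r_def by (simp add: less_floor_iff)
        then show "of_int (the (m i)) * t / 5 + t / 5 \<le> f i"
          using t by (simp add: le_divide_eq algebra_simps)
      next
        fix i assume "i \<in> dom m - \<tau>"
        then have "5 * f i / t < of_int (the (m i))"
          using f(3) unfolding r_def by (simp add: floor_less_iff)
        then show "f i \<le> of_int (the (m i)) * t / 5"
          using t by (simp add: divide_less_eq algebra_simps)
      qed
    qed
  qed (use fin t M in auto)
  then show ?thesis using inj by (simp add: card_image)
qed

section \<open>Cubes in projections of convex sets\<close>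

text \<open>
The hypothesis places a point of \<open>S\<close> beyond every vertex of the cube. The coordinates are made equal
to those of \<open>y\<close> one at a time: of two points that agree with \<open>y\<close> on the coordinates already treated,
one lying below and one above \<open>y\<close> in the next coordinate, a suitable convex combination agrees there
too and preserves all the other inequalities.
\<close>

lemma convex_fills_cube:
  fixes S :: "('i \<Rightarrow> real) set"
  assumes S: "convex S" and "finite \<sigma>"
    and corner: "\<And>\<tau>. \<tau> \<subseteq> \<sigma> \<Longrightarrow> \<exists>f\<in>S. (\<forall>i\<in>\<tau>. x i + h \<le> f i) \<and> (\<forall>i\<in>\<sigma> - \<tau>. f i \<le> x i)"
    and y: "\<And>i. i \<in> \<sigma> \<Longrightarrow> y i \<in> {x i..x i + h}"
  shows "\<exists>f\<in>S. \<forall>i\<in>\<sigma>. f i = y i"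
proof -
  have "\<forall>\<tau> \<subseteq> \<sigma> - \<rho>. \<exists>f\<in>S. (\<forall>i\<in>\<rho>. f i = y i) \<and> (\<forall>i\<in>\<tau>. x i + h \<le> f i) \<and>
      (\<forall>i\<in>\<sigma> - \<rho> - \<tau>. f i \<le> x i)" if "finite \<rho>" "\<rho> \<subseteq> \<sigma>" for \<rho>
    using that
  proof (induction \<rho> rule: finite_induct)
    case empty
    then show ?case using corner by simp
  next
    case (insert j \<rho>)
    show ?case
    proof (intro allI impI)
      fix \<tau> assume t: "\<tau> \<subseteq> \<sigma> - insert j \<rho>"
      have IH: "\<exists>f\<in>S. (\<forall>i\<in>\<rho>. f i = y i) \<and> (\<forall>i\<in>\<tau>'. x i + h \<le> f i) \<and>
          (\<forall>i\<in>\<sigma> - \<rho> - \<tau>'. f i \<le> x i)" if "\<tau>' \<subseteq> \<sigma> - \<rho>" for \<tau>'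
        using insert.IH insert.prems that by simp
      have j: "j \<in> \<sigma>" "j \<notin> \<rho>" "j \<notin> \<tau>" using insert t by auto
      obtain f where f: "f \<in> S" "\<forall>i\<in>\<rho>. f i = y i" "\<forall>i\<in>\<tau>. x i + h \<le> f i"
        "\<forall>i\<in>\<sigma> - \<rho> - \<tau>. f i \<le> x i"
        using IH[of \<tau>] t by auto
      obtain g where g: "g \<in> S" "\<forall>i\<in>\<rho>. g i = y i" "\<forall>i\<in>insert j \<tau>. x i + h \<le> g i"
        "\<forall>i\<in>\<sigma> - \<rho> - insert j \<tau>. g i \<le> x i"
        using IH[of "insert j \<tau>"] t j by auto
      have fj: "f j \<le> y j" and gj: "y j \<le> g j" using f(4) g(3) y[OF j(1)] j by force+
      obtain s where s: "0 \<le> s" "s \<le> 1" "(1 - s) * f j + s * g j = y j"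
      proof (cases "f j = g j")
        case True
        then show ?thesis using fj gj that[of 0] by simp
      next
        case False
        then have "0 < g j - f j" using fj gj by simp
        then have "(1 - (y j - f j) / (g j - f j)) * f j + (y j - f j) / (g j - f j) * g j = y j"
        proof -
          have "(1 - s) * f j + s * g j = f j + s * (g j - f j)" for s
            by (simp add: algebra_simps)
          then show ?thesis using \<open>0 < g j - f j\<close> by (simp only:) simp
        qed
        then show ?thesis using fj gj \<open>0 < g j - f j\<close>
          by (intro that[of "(y j - f j) / (g j - f j)"]) auto
      qed
      define k where "k = (1 - s) *\<^sub>R f + s *\<^sub>R g"
      have k: "k i = (1 - s) * f i + s * g i" for i
        by (simp add: k_def scaleR_fun_def)
      have "k \<in> S" unfolding k_def using S f(1) g(1) s by (intro convexD) auto
      moreover have "k i = y i" if "i \<in> insert j \<rho>" for i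
        using that f(2) g(2) s(3) by (auto simp: k algebra_simps)
      moreover have "x i + h \<le> k i" if "i \<in> \<tau>" for i
      proof -
        have "- f i \<le> - (x i + h)" "- g i \<le> - (x i + h)" using f(3) g(3) that by auto
        then have "(1 - s) * - f i + s * - g i \<le> - (x i + h)" 
          using s by (intro convex_bound_le) auto
        then show ?thesis by (simp add: k)
      qed
      moreover have "k i \<le> x i" if "i \<in> \<sigma> - insert j \<rho> - \<tau>" for i
        unfolding k using f(4) g(4) s that by (intro convex_bound_le) auto
      ultimately show "\<exists>f\<in>S. (\<forall>i\<in>insert j \<rho>. f i = y i) \<and> (\<forall>i\<in>\<tau>. x i + h \<le> f i) \<and>
          (\<forall>i\<in>\<sigma> - insert j \<rho> - \<tau>. f i \<le> x i)" by blast
    qed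
  qed
  \<comment> \<open>With all coordinates treated, no condition on \<open>\<tau>\<close> remains.\<close>
  from this[of \<sigma>] show ?thesis using assms(2) by auto
qed

lemma card_le_VC:
  fixes K :: "(nat \<Rightarrow> real) set"
  assumes K: "convex K" and \<sigma>: "\<sigma> \<subseteq> {..<n}" and h: "s \<le> h"
    and corner: "\<And>\<tau>. \<tau> \<subseteq> \<sigma> \<Longrightarrow> \<exists>f\<in>K. (\<forall>i\<in>\<tau>. x i + h \<le> f i) \<and> (\<forall>i\<in>\<sigma> - \<tau>. f i \<le> x i)"
  shows "card \<sigma> \<le> VC n K s"
proof -
  have "finite \<sigma>" using \<sigma> finite_subset by blast
  have "(\<Pi>\<^sub>E i\<in>\<sigma>. {x i..x i + s}) \<subseteq> (\<lambda>y. restrict y \<sigma>) ` K"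
  proof
    fix y assume y: "y \<in> (\<Pi>\<^sub>E i\<in>\<sigma>. {x i..x i + s})"
    have "\<exists>f\<in>K. \<forall>i\<in>\<sigma>. f i = y i"
    proof (rule convex_fills_cube[OF K \<open>finite \<sigma>\<close> corner])
      show "y i \<in> {x i..x i + h}" if "i \<in> \<sigma>" for i
        using PiE_mem[OF y that] h by auto
    qed
    then obtain f where f: "f \<in> K" "\<forall>i\<in>\<sigma>. f i = y i" by blast
    have "y = restrict f \<sigma>"
    proof
      fix i show "y i = restrict f \<sigma> i" using f(2) PiE_arb[OF y] by (cases "i \<in> \<sigma>") auto
    qed
    then show "y \<in> (\<lambda>y. restrict y \<sigma>) ` K" using f(1) by blast
  qed
  then have "card \<sigma> \<in> insert 0 (card ` {\<sigma>. \<sigma> \<subseteq> {..<n} \<and>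
      (\<exists>x :: nat \<Rightarrow> real. (\<Pi>\<^sub>E i\<in>\<sigma>. {x i..x i + s}) \<subseteq> (\<lambda>y. restrict y \<sigma>) ` K)})"
    using \<sigma> by blast
  moreover have "finite {\<sigma>. \<sigma> \<subseteq> {..<n} \<and>
      (\<exists>x :: nat \<Rightarrow> real. (\<Pi>\<^sub>E i\<in>\<sigma>. {x i..x i + s}) \<subseteq> (\<lambda>y. restrict y \<sigma>) ` K)}"
    by (rule finite_subset[of _ "Pow {..<n}"]) auto
  ultimately show ?thesis unfolding VC_def by (intro Max_ge) auto
qed

section \<open>Selecting few coordinates\<close>

text \<open>
The greedy choice: some coordinate hits at least the fraction \<open>q\<close> of the objects that are not hit
yet, so each step leaves at most a fraction \<open>1 - q \<le> exp (- q)\<close> of them.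
\<close>

lemma small_hitting_set:
  fixes q :: real
  assumes fin: "finite I" "finite P" and "I \<noteq> {}"
    and hit: "\<And>z. z \<in> P \<Longrightarrow> q * real (card I) \<le> real (card {i \<in> I. R z i})"
  shows "\<exists>J \<subseteq> I. card J \<le> k \<and>
    real (card {z \<in> P. \<forall>i\<in>J. \<not> R z i}) \<le> exp (- q * real k) * real (card P)"
proof (induction k)
  case 0
  show ?case by (intro exI[of _ "{}"]) auto
next
  case (Suc k)
  then obtain J where J: "J \<subseteq> I" "card J \<le> k"
    "real (card {z \<in> P. \<forall>i\<in>J. \<not> R z i}) \<le> exp (- q * real k) * real (card P)" by blast
  let ?U = "{z \<in> P. \<forall>i\<in>J. \<not> R z i}"
  have finU: "finite ?U" using fin by simp
  obtain i where i: "i \<in> I" "q * real (card ?U) \<le> real (card {z \<in> ?U. R z i})"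
  proof (rule ccontr)
    assume no: "\<not> thesis"
    have less: "real (card {z \<in> ?U. R z i}) < q * real (card ?U)" if "i \<in> I" for i
      using no that \<open>\<And>i. i \<in> I \<Longrightarrow> q * real (card ?U) \<le> real (card {z \<in> ?U. R z i}) \<Longrightarrow> thesis\<close>
      by (meson not_le)
    have "real (card ?U) * (q * real (card I)) = (\<Sum>z\<in>?U. q * real (card I))" by simp
    also have "\<dots> \<le> (\<Sum>z\<in>?U. real (card {i \<in> I. R z i}))" using hit by (intro sum_mono) auto
    also have "\<dots> = (\<Sum>z\<in>?U. \<Sum>i\<in>I. of_bool (R z i))"
      using fin by (intro sum.cong) (auto simp: Int_def intro!: arg_cong[where f=card])
    also have "\<dots> = (\<Sum>i\<in>I. \<Sum>z\<in>?U. of_bool (R z i))" by (rule sum.swap)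
    also have "\<dots> = (\<Sum>i\<in>I. real (card {z \<in> ?U. R z i}))"
      using finU by (intro sum.cong) (auto simp: Int_def intro!: arg_cong[where f=card])
    also have "\<dots> < (\<Sum>i\<in>I. q * real (card ?U))"
      using fin \<open>I \<noteq> {}\<close> less by (intro sum_strict_mono) auto
    finally show False by simp
  qed
  let ?J = "insert i J"
  have split: "{z \<in> P. \<forall>i\<in>?J. \<not> R z i} = ?U - {z \<in> ?U. R z i}" by auto
  have "real (card {z \<in> P. \<forall>i\<in>?J. \<not> R z i}) = real (card ?U) - real (card {z \<in> ?U. R z i})"
  proof -
    have sub: "{z \<in> ?U. R z i} \<subseteq> ?U" by auto
    moreover have "finite {z \<in> ?U. R z i}" by (rule finite_subset[OF sub finU])
    ultimately show ?thesis unfolding split using finU by (simp add: card_Diff_subset card_mono of_nat_diff)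
  qed
  also have "\<dots> \<le> (1 + - q) * real (card ?U)" using i(2) by (simp add: algebra_simps)
  also have "\<dots> \<le> exp (- q) * real (card ?U)"
    by (intro mult_right_mono exp_ge_add_one_self) auto
  also have "\<dots> \<le> exp (- q) * (exp (- q * real k) * real (card P))"
    using J(3) by (intro mult_left_mono) auto
  also have "\<dots> = exp (- q + - q * real k) * real (card P)" by (simp only: exp_add mult.assoc)
  also have "- q + - q * real k = - q * real (Suc k)" by (simp add: algebra_simps)
  finally have "real (card {z \<in> P. \<forall>i\<in>?J. \<not> R z i}) \<le> exp (- q * real (Suc k)) * real (card P)" .
  moreover have "?J \<subseteq> I" using J(1) i(1) by auto
  moreover have "card ?J \<le> Suc k"
    using J(2) finite_subset[OF J(1) fin(1)] by (simp add: card_insert_if)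
  ultimately show ?case by blast
qed

text \<open>
Coordinates with difference below \<open>t / 2\<close> contribute at most \<open>(t / 2)\<^sup>p n\<close> to the sum, the others at most
\<open>2\<^sup>p\<close> each; and \<open>t\<^sup>p - (t / 2)\<^sup>p \<ge> (t / 2)\<^sup>p = 2\<^sup>p (t / 4)\<^sup>p\<close> because \<open>p > 1\<close>.
\<close>

lemma lp_separated_coordinates:
  fixes f g :: "nat \<Rightarrow> real" and p t :: real
  assumes p: "1 < p" and t: "0 < t"
    and range: "\<And>i. i < n \<Longrightarrow> \<bar>f i - g i\<bar> \<le> 2"
    and sep: "t powr p * real n < (\<Sum>i<n. \<bar>f i - g i\<bar> powr p)"
  shows "(t / 4) powr p * real n \<le> real (card {i \<in> {..<n}. t / 2 \<le> \<bar>f i - g i\<bar>})"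
proof -
  let ?F = "{i \<in> {..<n}. t / 2 \<le> \<bar>f i - g i\<bar>}"
  have "(\<Sum>i<n. \<bar>f i - g i\<bar> powr p) \<le>
      (\<Sum>i<n. of_bool (t / 2 \<le> \<bar>f i - g i\<bar>) * 2 powr p + (t / 2) powr p)"
  proof (rule sum_mono)
    fix i assume i: "i \<in> {..<n}"
    show "\<bar>f i - g i\<bar> powr p \<le> of_bool (t / 2 \<le> \<bar>f i - g i\<bar>) * 2 powr p + (t / 2) powr p"
    proof (cases "t / 2 \<le> \<bar>f i - g i\<bar>")
      case True
      have "\<bar>f i - g i\<bar> powr p \<le> 2 powr p" using range[of i] i p by (intro powr_mono2) auto
      then show ?thesis using True by (simp add: add_increasing2)
    next
      case False
      then show ?thesis using p by (auto intro: powr_mono2)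
    qed
  qed
  also have "\<dots> = real (card ?F) * 2 powr p + real n * (t / 2) powr p"
    by (simp add: sum.distrib sum_distrib_right[symmetric] Int_def)
  finally have "t powr p * real n < real (card ?F) * 2 powr p + real n * (t / 2) powr p"
    using sep by simp
  moreover have "t powr p = 4 powr p * (t / 4) powr p" "(t / 2) powr p = 2 powr p * (t / 4) powr p"
    "(4::real) powr p = 2 powr p * 2 powr p"
    using t by (simp_all add: powr_mult[symmetric])
  ultimately have "2 powr p * ((2 powr p - 1) * ((t / 4) powr p * real n)) < 2 powr p * real (card ?F)"
    by (simp add: algebra_simps)
  then have "(2 powr p - 1) * ((t / 4) powr p * real n) \<le> real (card ?F)" by simp
  moreover have "2 \<le> (2::real) powr p" using p powr_mono[of 1 p 2] by simp
  then have "1 * ((t / 4) powr p * real n) \<le> (2 powr p - 1) * ((t / 4) powr p * real n)"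
    by (intro mult_right_mono) auto
  ultimately show ?thesis by simp
qed


text \<open>
Separation in the normalised \<open>p\<close>-norm of the whole space becomes separation in the maximum norm on
a coordinate set whose size is controlled by the logarithm of the cardinality, independently of
\<open>n\<close>. The number of steps exceeds \<open>2 ln N / q\<close>, so that fewer than one of the at most \<open>N\<^sup>2\<close> pairs
remains unseparated.
\<close>

lemma separating_coordinates:
  fixes A :: "(nat \<Rightarrow> real) set" and p t :: real
  assumes fin: "finite A" and A: "2 \<le> card A" and p: "1 < p" and t: "0 < t" "t \<le> 1"
    and range: "\<And>f i. f \<in> A \<Longrightarrow> i < n \<Longrightarrow> \<bar>f i\<bar> \<le> 1"
    and sep: "\<And>f g. f \<in> A \<Longrightarrow> g \<in> A \<Longrightarrow> f \<noteq> g \<Longrightarrow>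
      t powr p * real n < (\<Sum>i<n. \<bar>f i - g i\<bar> powr p)"
  obtains J where "J \<subseteq> {..<n}" "real (card J) \<le> 4 * (4 / t) powr p * ln (real (card A))"
    "\<And>f g. f \<in> A \<Longrightarrow> g \<in> A \<Longrightarrow> f \<noteq> g \<Longrightarrow> \<exists>i\<in>J. t / 2 \<le> \<bar>f i - g i\<bar>"
proof -
  define q where "q = (t / 4) powr p"
  define L where "L = ln (real (card A))"
  have q: "0 < q" "q \<le> 1" using t p unfolding q_def by (auto intro: powr_le1)
  have "2 / 3 \<le> ln (2::real)" by (rule ln2_ge_two_thirds)
  also have "\<dots> \<le> L" unfolding L_def using A by (subst ln_le_cancel_iff) auto
  finally have L: "2 / 3 \<le> L" .
  obtain f g where fg: "f \<in> A" "g \<in> A" "f \<noteq> g"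
    using A fin by (metis card_le_Suc0_iff_eq not_less_eq_eq numeral_2_eq_2)
  have n: "{..<n} \<noteq> {}"
  proof
    assume "{..<n} = {}"
    then have "n = 0" by auto
    then show False using sep[OF fg] by simp
  qed
  let ?P = "{z \<in> A \<times> A. fst z \<noteq> snd z}"
  let ?R = "\<lambda>z i. t / 2 \<le> \<bar>fst z i - snd z i\<bar>"
  define k where "k = nat \<lfloor>2 * L / q\<rfloor> + 1"
  have "0 \<le> 2 * L / q" using L q by simp
  then have k: "2 * L / q < real k" "real k \<le> 2 * L / q + 1" unfolding k_def by linarith+
  have finP: "finite ?P" using fin by simp
  have "\<exists>J \<subseteq> {..<n}. card J \<le> k \<and>
      real (card {z \<in> ?P. \<forall>i\<in>J. \<not> ?R z i}) \<le> exp (- q * real k) * real (card ?P)"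
  proof (rule small_hitting_set[OF _ finP n])
    fix z assume z: "z \<in> ?P"
    show "q * real (card {..<n}) \<le> real (card {i \<in> {..<n}. ?R z i})"
      unfolding q_def card_lessThan
    proof (rule lp_separated_coordinates[OF p t(1)])
      show "\<bar>fst z i - snd z i\<bar> \<le> 2" if "i < n" for i
        using range[of "fst z" i] range[of "snd z" i] z that by auto
      show "t powr p * real n < (\<Sum>i<n. \<bar>fst z i - snd z i\<bar> powr p)"
        using z by (intro sep) auto
    qed
  qed simp
  then obtain J where J: "J \<subseteq> {..<n}" "card J \<le> k"
    "real (card {z \<in> ?P. \<forall>i\<in>J. \<not> ?R z i}) \<le> exp (- q * real k) * real (card ?P)" by blast
  have "card ?P \<le> card (A \<times> A)" using fin by (intro card_mono) auto
  then have "card ?P \<le> card A * card A" by (simp only: card_cartesian_product)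
  then have "real (card ?P) \<le> real (card A) * real (card A)"
    unfolding of_nat_mult[symmetric] by (rule of_nat_mono)
  also have "\<dots> = exp (2 * L)"
    using A unfolding L_def by (simp add: exp_double power2_eq_square)
  finally have P: "real (card ?P) \<le> exp (2 * L)" .
  have "real (card {z \<in> ?P. \<forall>i\<in>J. \<not> ?R z i}) \<le> exp (- q * real k) * exp (2 * L)"
    by (rule order.trans[OF J(3)]) (intro mult_left_mono P, simp)
  also have "\<dots> = exp (2 * L - q * real k)" by (simp add: exp_add[symmetric])
  also have "\<dots> < 1" using k(1) q by (simp add: divide_less_eq mult.commute)
  finally have "card {z \<in> ?P. \<forall>i\<in>J. \<not> ?R z i} = 0" by simp
  moreover have "finite {z \<in> ?P. \<forall>i\<in>J. \<not> ?R z i}"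
    by (rule finite_subset[OF _ finP]) auto
  ultimately have none: "{z \<in> ?P. \<forall>i\<in>J. \<not> ?R z i} = {}" by (simp only: card_0_eq)
  show ?thesis
  proof (rule that[OF J(1)])
    show "\<exists>i\<in>J. t / 2 \<le> \<bar>f i - g i\<bar>" if "f \<in> A" "g \<in> A" "f \<noteq> g" for f g
    proof (rule ccontr)
      assume "\<not> ?thesis"
      then have "(f, g) \<in> {z \<in> ?P. \<forall>i\<in>J. \<not> ?R z i}" using that by simp
      then show False using none by blast
    qed
    have "1 \<le> 2 * L / q" using L q by (simp add: le_divide_eq)
    then have "real (card J) \<le> 4 * L / q" using J(2) k(2) by linarith
    also have "\<dots> = 4 * (4 / t) powr p * L"
      using t by (simp add: q_def powr_divide field_simps)
    finally show "real (card J) \<le> 4 * (4 / t) powr p * ln (real (card A))" by (simp add: L_def)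
  qed
qed

section \<open>Covering numbers\<close>

lemma card_sup_separated_le:
  fixes A :: "(nat \<Rightarrow> real) set" and t :: real
  assumes t: "0 < t" and fin: "finite A" and A: "A \<subseteq> linf_ball n"
    and sep: "\<And>f g. f \<in> A \<Longrightarrow> g \<in> A \<Longrightarrow> f \<noteq> g \<Longrightarrow> \<exists>i<n. t < \<bar>f i - g i\<bar>"
  shows "card A \<le> card ({..<n} \<rightarrow>\<^sub>E {\<lfloor>- 1 / t\<rfloor>..\<lfloor>1 / t\<rfloor>})"
proof (rule card_inj_on_le)
  let ?r = "\<lambda>f. \<lambda>i\<in>{..<n}. \<lfloor>f i / t\<rfloor>"
  show "inj_on ?r A"
  proof (rule inj_onI, rule ccontr)
    fix f g assume fg: "f \<in> A" "g \<in> A" "?r f = ?r g" "f \<noteq> g"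
    then obtain i where i: "i < n" "t < \<bar>f i - g i\<bar>" using sep by blast
    have "\<lfloor>f i / t\<rfloor> = \<lfloor>g i / t\<rfloor>" using fun_cong[OF fg(3), of i] i(1) by simp
    then have "\<bar>f i / t - g i / t\<bar> < 1" by linarith
    then have "\<bar>f i - g i\<bar> / t < 1" using t by (simp add: diff_divide_distrib[symmetric])
    then show False using i(2) t by (simp add: divide_less_eq)
  qed
  show "?r ` A \<subseteq> {..<n} \<rightarrow>\<^sub>E {\<lfloor>- 1 / t\<rfloor>..\<lfloor>1 / t\<rfloor>}"
  proof (rule image_subsetI, rule restrict_PiE_iff[THEN iffD2], rule ballI)
    fix f i assume "f \<in> A" "i \<in> {..<n}"
    then have "\<bar>f i\<bar> \<le> 1" using A by (auto simp: linf_ball_def)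
    then have "- 1 / t \<le> f i / t" "f i / t \<le> 1 / t"
      using t by (intro divide_right_mono; simp add: abs_le_iff)+
    then show "\<lfloor>f i / t\<rfloor> \<in> {\<lfloor>- 1 / t\<rfloor>..\<lfloor>1 / t\<rfloor>}" by (auto intro: floor_mono)
  qed
qed (auto intro: finite_PiE)

text \<open>
A maximal subset whose members are pairwise not \<open>close\<close> is a net. It is finite because members that
are not \<open>close\<close> are also separated in the maximum norm, in a bounded set. The relation is left
abstract so that both norms are covered.
\<close>

lemma sup_separated_net:
  fixes K :: "(nat \<Rightarrow> real) set" and t :: real
  assumes t: "0 < t" and K: "K \<subseteq> linf_ball n"
    and refl: "\<And>f. f \<in> K \<Longrightarrow> close f f"
    and sym: "\<And>f g. close f g \<Longrightarrow> close g f"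
    and far: "\<And>f g. \<not> close f g \<Longrightarrow> \<exists>i<n. t < \<bar>f i - g i\<bar>"
    and cover: "\<And>f g. f \<in> K \<Longrightarrow> g \<in> K \<Longrightarrow> close f g \<Longrightarrow> f \<in> (\<lambda>d. g + t *\<^sub>R d) ` D"
  obtains A where "finite A" "A \<subseteq> K" "covering_number n K D t \<le> card A"
    "\<And>f g. f \<in> A \<Longrightarrow> g \<in> A \<Longrightarrow> f \<noteq> g \<Longrightarrow> \<not> close f g"
proof -
  obtain A where A: "finite A" "A \<subseteq> K" "\<And>f g. f \<in> A \<Longrightarrow> g \<in> A \<Longrightarrow> f \<noteq> g \<Longrightarrow> \<not> close f g"
    "\<And>f. f \<in> K \<Longrightarrow> \<exists>g\<in>A. close f g"
  proof (rule maximal_separated_subset[of K close "card ({..<n} \<rightarrow>\<^sub>E {\<lfloor>- 1 / t\<rfloor>..\<lfloor>1 / t\<rfloor>})"])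
    show "card A \<le> card ({..<n} \<rightarrow>\<^sub>E {\<lfloor>- 1 / t\<rfloor>..\<lfloor>1 / t\<rfloor>})"
      if "finite A" "A \<subseteq> K" "\<And>x y. x \<in> A \<Longrightarrow> y \<in> A \<Longrightarrow> x \<noteq> y \<Longrightarrow> \<not> close x y" for A
      using that K by (intro card_sup_separated_le[OF t] far) auto
  qed (use refl sym in auto)
  have "K \<subseteq> (\<Union>g\<in>A. (\<lambda>d. g + t *\<^sub>R d) ` D)"
  proof
    fix f assume f: "f \<in> K"
    then obtain g where "g \<in> A" "close f g" using A(4) by blast
    then show "f \<in> (\<Union>g\<in>A. (\<lambda>d. g + t *\<^sub>R d) ` D)" using cover[OF f] A(2) by blast
  qed
  moreover have "A \<subseteq> topspace (Euclidean_space n)" using A(2) K by (auto simp: linf_ball_def)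
  ultimately have "covering_number n K D t \<le> card A"
    unfolding covering_number_def using A(1) by (intro Least_le exI[of _ A]) auto
  then show ?thesis using that A by blast
qed

lemma ln_nat_le_ln_nat:
  assumes "a \<le> b" "2 \<le> a" shows "ln (real a) \<le> ln (real b)"
  using assms by (subst ln_le_cancel_iff) auto

lemma ln_covering_number_linf_le:
  fixes K :: "(nat \<Rightarrow> real) set" and t M :: real
  assumes K: "convex K" "K \<subseteq> linf_ball n" and t: "0 < t" "t < 1" and M: "1 \<le> M"
    and large: "t powr M * real n < ln (real (covering_number n K (linf_ball n) t))"
  shows "ln (real (covering_number n K (linf_ball n) t))
    \<le> 7000 * (M * ln (2 / t))\<^sup>2 * real (VC n K (t / 10))"
proof -
  let ?N = "covering_number n K (linf_ball n) t"
  have zero: "f i = 0" if "f \<in> K" "n \<le> i" for f i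
    using that K(2) by (auto simp: linf_ball_def topspace_Euclidean_space)
  define close where "close f g \<longleftrightarrow> (\<forall>i<n. \<bar>f i - g i\<bar> \<le> t)" for f g :: "nat \<Rightarrow> real"
  obtain A where A: "finite A" "A \<subseteq> K" "?N \<le> card A"
    "\<And>f g. f \<in> A \<Longrightarrow> g \<in> A \<Longrightarrow> f \<noteq> g \<Longrightarrow> \<not> close f g"
  proof (rule sup_separated_net[OF t(1) K(2), of close "linf_ball n"])
    fix f g assume fg: "f \<in> K" "g \<in> K" "close f g"
    show "f \<in> (\<lambda>d. g + t *\<^sub>R d) ` linf_ball n"
    proof (rule image_eqI)
      show "f = g + t *\<^sub>R (\<lambda>i. (f i - g i) / t)"
        using t by (simp add: fun_eq_iff scaleR_fun_def)
      show "(\<lambda>i. (f i - g i) / t) \<in> linf_ball n"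
        using fg(3) zero[OF fg(1)] zero[OF fg(2)] t
        by (simp add: linf_ball_def close_def topspace_Euclidean_space divide_le_eq)
    qed
  qed (use t in \<open>auto simp: close_def abs_minus_commute not_le\<close>)
  have "0 < ln (real ?N)"
    using large by (rule le_less_trans[rotated]) simp
  then have "2 \<le> ?N" by (cases "?N = 0"; cases "?N = 1") auto
  then have N: "ln (real ?N) \<le> ln (real (card A))" "2 \<le> card A"
    using ln_nat_le_ln_nat[OF A(3)] A(3) by auto
  have "ln (real (card A)) \<le> 7000 * (M * ln (2 / t))\<^sup>2 * real (VC n K (t / 10))"
  proof (rule ln_card_separated_le[where I = "{..<n}"])
    show "\<bar>f i\<bar> \<le> 1" if "f \<in> A" "i \<in> {..<n}" for f i
      using that A(2) K(2) by (auto simp: linf_ball_def)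
    show "\<exists>i\<in>{..<n}. t \<le> \<bar>f i - g i\<bar>" if "f \<in> A" "g \<in> A" "f \<noteq> g" for f g
      using A(4)[OF that] by (force simp: close_def)
    show "real (card {..<n}) \<le> (2 / t) powr M * ln (real (card A))"
    proof -
      have "real n = (1 / t) powr M * (t powr M * real n)"
        using t by (simp add: powr_divide)
      also have "\<dots> \<le> (2 / t) powr M * ln (real (card A))"
        using large N t M by (intro mult_mono powr_mono2 divide_right_mono) auto
      finally show ?thesis by simp
    qed
    fix \<sigma> and x :: "nat \<Rightarrow> real"
    assume s: "\<sigma> \<subseteq> {..<n}" and c: "\<And>\<tau>. \<tau> \<subseteq> \<sigma> \<Longrightarrow>
      \<exists>f\<in>A. (\<forall>i\<in>\<tau>. x i + t / 5 \<le> f i) \<and> (\<forall>i\<in>\<sigma> - \<tau>. f i \<le> x i)"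
    show "card \<sigma> \<le> VC n K (t / 10)"
    proof (rule card_le_VC[OF K(1) s])
      show "\<exists>f\<in>K. (\<forall>i\<in>\<tau>. x i + t / 5 \<le> f i) \<and> (\<forall>i\<in>\<sigma> - \<tau>. f i \<le> x i)" if "\<tau> \<subseteq> \<sigma>" for \<tau>
        using c[OF that] A(2) by blast
    qed (use t in auto)
  qed (use A t M N in auto)
  then show ?thesis using N by linarith
qed

text \<open>
After the selection of coordinates the maximum norm estimate applies with \<open>t / 2\<close> for \<open>t\<close> and \<open>p + 1\<close>
for \<open>M\<close>: the extra factor \<open>4 \<le> 4 / t\<close> in the bound for \<open>card J\<close> accounts for the additional \<open>1\<close>.
\<close>

lemma ln_covering_number_lp_le:
  fixes K :: "(nat \<Rightarrow> real) set" and t p :: real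
  assumes K: "convex K" "K \<subseteq> linf_ball n" and t: "0 < t" "t < 1" and p: "1 < p" and n: "1 \<le> n"
  shows "ln (real (covering_number n K ((\<lambda>x. (real n powr (1 / p)) *\<^sub>R x) ` lp_ball p n) t))
    \<le> 112000 * p\<^sup>2 * (ln (2 / t))\<^sup>2 * real (VC n K (t / 10))"
proof -
  let ?D = "(\<lambda>x. (real n powr (1 / p)) *\<^sub>R x) ` lp_ball p n"
  let ?N = "covering_number n K ?D t"
  have zero: "f i = 0" if "f \<in> K" "n \<le> i" for f i
    using that K(2) by (auto simp: linf_ball_def topspace_Euclidean_space)
  define close where "close f g \<longleftrightarrow> (\<Sum>i<n. \<bar>f i - g i\<bar> powr p) \<le> t powr p * real n"
    for f g :: "nat \<Rightarrow> real"
  obtain A where A: "finite A" "A \<subseteq> K" "?N \<le> card A"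
    "\<And>f g. f \<in> A \<Longrightarrow> g \<in> A \<Longrightarrow> f \<noteq> g \<Longrightarrow> \<not> close f g"
  proof (rule sup_separated_net[OF t(1) K(2), of close ?D])
    show "close f f" for f by (simp add: close_def)
    show "close g f" if "close f g" for f g
      using that by (simp add: close_def abs_minus_commute)
    show "\<exists>i<n. t < \<bar>f i - g i\<bar>" if "\<not> close f g" for f g
    proof (rule ccontr)
      assume "\<not> ?thesis"
      then have "\<bar>f i - g i\<bar> \<le> t" if "i < n" for i using that by (meson not_less)
      then have "(\<Sum>i<n. \<bar>f i - g i\<bar> powr p) \<le> (\<Sum>i<n. t powr p)"
        using p by (intro sum_mono powr_mono2) auto
      then show False using that by (simp add: close_def mult.commute)
    qed
    fix f g assume fg: "f \<in> K" "g \<in> K" "close f g"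
    define s where "s = real n powr (1 / p)"
    have s: "0 < s" "s powr p = real n" using n p by (simp_all add: s_def powr_powr)
    define d where "d = (\<lambda>i. (f i - g i) / (t * s))"
    have "(\<Sum>i<n. \<bar>d i\<bar> powr p) = (\<Sum>i<n. \<bar>f i - g i\<bar> powr p) / (t powr p * real n)"
      unfolding sum_divide_distrib using t s
      by (intro sum.cong refl) (simp add: d_def abs_mult powr_divide powr_mult)
    also have "\<dots> \<le> 1" using fg(3) t n by (simp add: close_def divide_le_eq)
    finally have "(\<Sum>i<n. \<bar>d i\<bar> powr p) powr (1 / p) \<le> 1 powr (1 / p)"
      using p by (intro powr_mono2 sum_nonneg) auto
    then have "d \<in> lp_ball p n"
      using zero[OF fg(1)] zero[OF fg(2)] by (simp add: lp_ball_def d_def topspace_Euclidean_space)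
    moreover have "f = g + t *\<^sub>R (s *\<^sub>R d)"
      using t s by (simp add: fun_eq_iff scaleR_fun_def d_def)
    ultimately show "f \<in> (\<lambda>d. g + t *\<^sub>R d) ` ?D" unfolding s_def by blast
  qed auto
  show ?thesis
  proof (cases "2 \<le> ?N")
    case False
    then have "?N = 0 \<or> ?N = 1" by linarith
    then have "ln (real ?N) = 0" by auto
    then show ?thesis by simp
  next
    case True
    then have N: "ln (real ?N) \<le> ln (real (card A))" "2 \<le> card A"
      using ln_nat_le_ln_nat[OF A(3)] A(3) by auto
    define L where "L = ln (real (card A))"
    have L0: "0 \<le> L" unfolding L_def using N by simp
    have range: "\<bar>f i\<bar> \<le> 1" if "f \<in> A" "i < n" for f i
      using that A(2) K(2) by (auto simp: linf_ball_def)
    obtain J where J: "J \<subseteq> {..<n}" "real (card J) \<le> 4 * (4 / t) powr p * L"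
      "\<And>f g. f \<in> A \<Longrightarrow> g \<in> A \<Longrightarrow> f \<noteq> g \<Longrightarrow> \<exists>i\<in>J. t / 2 \<le> \<bar>f i - g i\<bar>"
      unfolding L_def
    proof (rule separating_coordinates[OF A(1) N(2) p t(1), of n])
      show "t powr p * real n < (\<Sum>i<n. \<bar>f i - g i\<bar> powr p)"
        if "f \<in> A" "g \<in> A" "f \<noteq> g" for f g
        using A(4)[OF that] by (simp add: close_def not_le)
    qed (use t range in auto)
    have "L \<le> 7000 * ((p + 1) * ln (2 / (t / 2)))\<^sup>2 * real (VC n K (t / 10))"
      unfolding L_def
    proof (rule ln_card_separated_le[where I = J])
      show "finite J" using J(1) finite_subset by blast
      show "\<bar>f i\<bar> \<le> 1" if "f \<in> A" "i \<in> J" for f i using that J(1) range by auto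
      show "real (card J) \<le> (2 / (t / 2)) powr (p + 1) * ln (real (card A))"
      proof -
        have "4 * (4 / t) powr p * L \<le> (4 / t) * (4 / t) powr p * L"
          using t L0 by (intro mult_right_mono) (auto simp: le_divide_eq)
        then show ?thesis using J(2) t by (simp add: powr_add L_def mult_ac)
      qed
      fix \<sigma> and x :: "nat \<Rightarrow> real"
      assume s: "\<sigma> \<subseteq> J" and c: "\<And>\<tau>. \<tau> \<subseteq> \<sigma> \<Longrightarrow>
        \<exists>f\<in>A. (\<forall>i\<in>\<tau>. x i + t / 2 / 5 \<le> f i) \<and> (\<forall>i\<in>\<sigma> - \<tau>. f i \<le> x i)"
      show "card \<sigma> \<le> VC n K (t / 10)"
      proof (rule card_le_VC[OF K(1)])
        show "\<sigma> \<subseteq> {..<n}" using s J(1) by blast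
        show "\<exists>f\<in>K. (\<forall>i\<in>\<tau>. x i + t / 2 / 5 \<le> f i) \<and> (\<forall>i\<in>\<sigma> - \<tau>. f i \<le> x i)" if "\<tau> \<subseteq> \<sigma>" for \<tau>
          using c[OF that] A(2) by blast
      qed (use t in auto)
    qed (use A t p N J in auto)
    also have "\<dots> \<le> 7000 * ((2 * p) * (2 * ln (2 / t)))\<^sup>2 * real (VC n K (t / 10))"
    proof (intro mult_right_mono mult_left_mono power_mono mult_mono)
      have "ln (2 / (t / 2)) = ln 2 + ln (2 / t)" using t ln_mult[of 2 "2 / t"] by simp
      also have "ln 2 \<le> ln (2 / t)" using t by (subst ln_le_cancel_iff) (auto simp: le_divide_eq)
      finally show "ln (2 / (t / 2)) \<le> 2 * ln (2 / t)" by simp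
    qed (use p t in auto)
    also have "\<dots> = 112000 * p\<^sup>2 * (ln (2 / t))\<^sup>2 * real (VC n K (t / 10))"
      by (simp add: power_mult_distrib)
    finally show ?thesis using N(1) by (simp add: L_def)
  qed
qed

theorem theorem1p1:
  shows "\<exists>C c :: real. C > 0 \<and> c > 0 \<and>
    (\<forall>(n :: nat) (K :: (nat \<Rightarrow> real) set) (t :: real).
      n \<ge> 1 \<and> convex_body n K \<and> K \<subseteq> linf_ball n \<and> 0 < t \<and> t < 1 \<longrightarrow>
      (\<forall>p :: real. p > 1 \<longrightarrow>
        ln (real (covering_number n K ((\<lambda>x. (real n powr (1 / p)) *\<^sub>R x) ` lp_ball p n) t))
          \<le> C * p\<^sup>2 * (ln (2 / t))\<^sup>2 * real (VC n K (c * t))) \<and>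
      (\<forall>M :: real. M \<ge> 1 \<longrightarrow>
        C * M\<^sup>2 * (ln (2 / t))\<^sup>2 * real (VC n K (c * t)) > t powr M * real n \<or>
        ln (real (covering_number n K (linf_ball n) t)) > t powr M * real n \<longrightarrow>
        ln (real (covering_number n K (linf_ball n) t))
          \<le> C * M\<^sup>2 * (ln (2 / t))\<^sup>2 * real (VC n K (c * t))))"
proof (rule exI[of _ 112000], rule exI[of _ "1 / 10"], intro conjI allI impI)
  fix n :: nat and K :: "(nat \<Rightarrow> real) set" and t p :: real
  assume "n \<ge> 1 \<and> convex_body n K \<and> K \<subseteq> linf_ball n \<and> 0 < t \<and> t < 1" "p > 1"
  then show "ln (real (covering_number n K ((\<lambda>x. (real n powr (1 / p)) *\<^sub>R x) ` lp_ball p n) t))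
      \<le> 112000 * p\<^sup>2 * (ln (2 / t))\<^sup>2 * real (VC n K (1 / 10 * t))"
    using ln_covering_number_lp_le[of K n t p] by (simp add: convex_body_def)
next
  fix n :: nat and K :: "(nat \<Rightarrow> real) set" and t M :: real
  assume K: "n \<ge> 1 \<and> convex_body n K \<and> K \<subseteq> linf_ball n \<and> 0 < t \<and> t < 1" and M: "M \<ge> 1"
    and large: "112000 * M\<^sup>2 * (ln (2 / t))\<^sup>2 * real (VC n K (1 / 10 * t)) > t powr M * real n \<or>
      ln (real (covering_number n K (linf_ball n) t)) > t powr M * real n"
  let ?R = "M\<^sup>2 * (ln (2 / t))\<^sup>2 * real (VC n K (t / 10))"
  have R: "0 \<le> ?R" by simp
  show "ln (real (covering_number n K (linf_ball n) t))
      \<le> 112000 * M\<^sup>2 * (ln (2 / t))\<^sup>2 * real (VC n K (1 / 10 * t))"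
  proof (cases "t powr M * real n < ln (real (covering_number n K (linf_ball n) t))")
    case True
    then have "ln (real (covering_number n K (linf_ball n) t)) \<le> 7000 * ?R"
      using ln_covering_number_linf_le[of K n t M] K M
      by (simp add: convex_body_def power_mult_distrib)
    also have "\<dots> \<le> 112000 * ?R" using R by linarith
    finally show ?thesis by (simp add: mult.assoc)
  next
    case False
    then show ?thesis using large by linarith
  qed
qed auto

end
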